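(* Let $\Lambda$ be a time-consistent family of probability measures, with associated set $\Theta=\{\theta: Q^\theta\in\Lambda\}\cap\{Q\text{-vector processes}\}$. Let $U=(U_t)_{0\le t\le T}$ be a real-valued adapted process with $U_T\in L^1(\mathcal{F}_T;\mathbb{R})$, and let $(Y,Z,K)$ be the solution of the reflected backward stochastic difference equation, for $0\le t<T$, $$Y_t=Y_{t+1}+\inf_{\theta\in\Theta}\{Z_t^*\theta_t\}-Z_t^*M_{t+1}+K_{t+1}-K_t,\quad Y_T=U_T,\quad Y_t\ge U_t,\quad (Y_t-U_t)(K_{t+1}-K_t)=0\quad P\text{-a.s.}$$ Then $Y$ is the multiple prior Snell envelope of $U$ with multiple prior set $\Lambda$; that is, $Y=\bar U$, where $\bar U_T=U_T$ and $$\bar U_t=\max\Big\{U_t,\ \inf_{Q\in\Lambda}E^Q[\bar U_{t+1}\mid\mathcal{F}_t]\Big\},\qquad t\in\{0,1,\dots,T-1\}.$$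
   Context: Setting: $T$ is a positive integer, $m\ge 1$, and $X=(X_t)_{0\le t\le T}$ is a stochastic process with values in the set of standard basis vectors $\{e_1,\dots,e_m\}$ of $\mathbb{R}^m$ on a probability space $(\Omega,\mathcal{F},P)$; $\mathcal{F}_t$ is the completion of $\sigma(X_0,\dots,X_t)$, $\mathcal{F}=\mathcal{F}_T$, and $\mathcal{F}_0$ is $P$-trivial. $M_t=X_t-E[X_t\mid\mathcal{F}_{t-1}]$ for $t=1,\dots,T$. $[\cdot]^*$ denotes transposition; infima of random variables are essential infima. The family $\Lambda$ is non-empty and consists of measures equivalent to $P$. In the reflected equation, $Y,Z,K$ are adapted integrable processes with values in $\mathbb{R},\mathbb{R}^m,\mathbb{R}$, and $K$ is increasing (non-decreasing) in $t$ with $K_0=0$. The equation is taken to have a unique solution, uniqueness being understood up to indistinguishability for $Y$ and, for $Z$, up to $P$-a.s. equality of the random variables $Z_t^*M_{t+1}$, $0\le t<T$. $Q$-vector process: with $\mathcal{Q}_t=\{i:P(X_{t+1}=e_i\mid\mathcal{F}_t)>0\}$, an adapted integrable $\mathbb{R}^m$-valued process $\theta=(\theta_t)_{0\le t<T}$ such that $\sum_j\langle\theta_t,e_j\rangle=0$ and $\langle\theta_t,e_i\rangle=0$ for all $i\notin\mathcal{Q}_t$. Measures $Q^\theta$: let $\psi_t=E[M_{t+1}M_{t+1}^*\mid\mathcal{F}_t]$ with Moore–Penrose pseudoinverse $\psi_t^+$. Every probability measure $Q\sim P$ on $\mathcal{F}_T$ can be written as $Q=Q^\theta$, where $\frac{dQ^\theta}{dP}=\prod_{0\le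 s<T}(1+\theta_s^*\psi_s^+M_{s+1})$ for a $Q$-vector process $\theta$; one has $E^{Q^\theta}[M_{t+1}\mid\mathcal{F}_t]=\theta_t$. A family $\Lambda$ of probability measures is time-consistent if for any $Q,Q'\in\Lambda$, any $t$ and any $A\in\mathcal{F}_t$, the measure $Q''(B)=E_Q\big[I_A E_{Q'}[I_B\mid\mathcal{F}_t]+I_{A^c}I_B\big]$ belongs to $\Lambda$. *)

theory Defs
  imports "HOL-Probability.Probability"
begin

text \<open>
  The number of states is the cardinality of a finite index type \<open>'m\<close>; the state space is
  the set of standard basis vectors \<open>axis i 1\<close> of \<open>real ^ 'm\<close>, and random vectors are treated
  coordinatewise. \<open>Pr\<close> is the reference probability measure, and only the values of a process
  at times up to the horizon \<open>T\<close> matter.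
\<close>

definition natural_sigma :: "'a measure \<Rightarrow> (nat \<Rightarrow> 'a \<Rightarrow> real ^ 'm) \<Rightarrow> nat \<Rightarrow> 'a measure" where
  "natural_sigma Pr X t = sigma (space Pr) {X s -` B \<inter> space Pr | s B. s \<le> t \<and> B \<in> sets borel}"

definition filt :: "'a measure \<Rightarrow> (nat \<Rightarrow> 'a \<Rightarrow> real ^ 'm) \<Rightarrow> nat \<Rightarrow> 'a measure" where
  "filt Pr X t = completion (restr_to_subalg Pr (natural_sigma Pr X t))"

definition vec_cond_exp ::
  "'a measure \<Rightarrow> 'a measure \<Rightarrow> ('a \<Rightarrow> real ^ 'm) \<Rightarrow> 'a \<Rightarrow> real ^ 'm" where
  "vec_cond_exp Pr F f = (\<lambda>\<omega>. \<chi> i. real_cond_exp Pr F (\<lambda>\<omega>'. f \<omega>' $ i) \<omega>)"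

text \<open>Only used for times \<open>t \<ge> 1\<close>.\<close>

definition mart_diff ::
  "'a measure \<Rightarrow> (nat \<Rightarrow> 'a \<Rightarrow> real ^ 'm) \<Rightarrow> nat \<Rightarrow> 'a \<Rightarrow> real ^ 'm" where
  "mart_diff Pr X t = (\<lambda>\<omega>. X t \<omega> - vec_cond_exp Pr (filt Pr X (t - 1)) (X t) \<omega>)"

definition psi ::
  "'a measure \<Rightarrow> (nat \<Rightarrow> 'a \<Rightarrow> real ^ 'm) \<Rightarrow> nat \<Rightarrow> 'a \<Rightarrow> real ^ 'm ^ 'm" where
  "psi Pr X t = (\<lambda>\<omega>. \<chi> i j. real_cond_exp Pr (filt Pr X t)
     (\<lambda>\<omega>'. mart_diff Pr X (Suc t) \<omega>' $ i * mart_diff Pr X (Suc t) \<omega>' $ j) \<omega>)"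

text \<open>The Moore-Penrose pseudoinverse, given by the four Penrose equations.\<close>

definition pinv :: "real ^ 'n ^ 'm \<Rightarrow> real ^ 'm ^ 'n" where
  "pinv A = (THE B. A ** B ** A = A \<and> B ** A ** B = B \<and>
     transpose (A ** B) = A ** B \<and> transpose (B ** A) = B ** A)"

definition reachable ::
  "'a measure \<Rightarrow> (nat \<Rightarrow> 'a \<Rightarrow> real ^ 'm) \<Rightarrow> nat \<Rightarrow> 'a \<Rightarrow> 'm set" where
  "reachable Pr X t \<omega> =
     {i. real_cond_exp Pr (filt Pr X t) (indicator {\<omega>' \<in> space Pr. X (Suc t) \<omega>' = axis i 1}) \<omega> > 0}"

text \<open>
  The pointwise conditions hold almost surely, since \<open>reachable\<close> depends on the chosen version
  of a conditional probability.
\<close>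

definition Q_vector_process ::
  "'a measure \<Rightarrow> (nat \<Rightarrow> 'a \<Rightarrow> real ^ 'm) \<Rightarrow> nat \<Rightarrow> (nat \<Rightarrow> 'a \<Rightarrow> real ^ 'm) \<Rightarrow> bool" where
  "Q_vector_process Pr X T \<theta> \<longleftrightarrow>
     (\<forall>t<T. \<theta> t \<in> borel_measurable (filt Pr X t) \<and> integrable Pr (\<theta> t) \<and>
        (AE \<omega> in Pr. (\<Sum>j\<in>UNIV. \<theta> t \<omega> $ j) = 0 \<and>
           (\<forall>i. i \<notin> reachable Pr X t \<omega> \<longrightarrow> \<theta> t \<omega> $ i = 0)))"

definition theta_density ::
  "'a measure \<Rightarrow> (nat \<Rightarrow> 'a \<Rightarrow> real ^ 'm) \<Rightarrow> nat \<Rightarrow> (nat \<Rightarrow> 'a \<Rightarrow> real ^ 'm) \<Rightarrow> 'a \<Rightarrow> real" where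
  "theta_density Pr X T \<theta> \<omega> =
     (\<Prod>s<T. 1 + \<theta> s \<omega> \<bullet> (pinv (psi Pr X s \<omega>) *v mart_diff Pr X (Suc s) \<omega>))"

text \<open>
  The nonnegativity requirement says that the (a priori signed) product really is a density;
  \<open>ennreal\<close> would otherwise truncate its negative part.
\<close>

definition Theta_set ::
  "'a measure \<Rightarrow> (nat \<Rightarrow> 'a \<Rightarrow> real ^ 'm) \<Rightarrow> nat \<Rightarrow> 'a measure set \<Rightarrow> (nat \<Rightarrow> 'a \<Rightarrow> real ^ 'm) set" where
  "Theta_set Pr X T \<Lambda> =
     {\<theta>. Q_vector_process Pr X T \<theta> \<and>
        (AE \<omega> in Pr. 0 \<le> theta_density Pr X T \<theta> \<omega>) \<and>
        density Pr (\<lambda>\<omega>. ennreal (theta_density Pr X T \<theta> \<omega>)) \<in> \<Lambda>}"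

definition time_consistent ::
  "'a measure \<Rightarrow> (nat \<Rightarrow> 'a \<Rightarrow> real ^ 'm) \<Rightarrow> nat \<Rightarrow> 'a measure set \<Rightarrow> bool" where
  "time_consistent Pr X T \<Lambda> \<longleftrightarrow>
     (\<forall>Q\<in>\<Lambda>. \<forall>Q'\<in>\<Lambda>. \<forall>t\<le>T. \<forall>A\<in>sets (filt Pr X t). \<exists>Q''\<in>\<Lambda>. \<forall>B\<in>sets Pr.
        measure Q'' B =
          (\<integral>\<omega>. indicator A \<omega> * real_cond_exp Q' (filt Pr X t) (indicator B) \<omega>
              + indicator (space Pr - A) \<omega> * indicator B \<omega> \<partial>Q))"

text \<open>
  \<open>is_ess_inf Pr I f g\<close>: \<open>g\<close> is (a version of) the essential infimum of the real random variables
  \<open>f i\<close>, \<open>i \<in> I\<close>. It is unique up to null sets and may take infinite values.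
\<close>

definition is_ess_inf ::
  "'a measure \<Rightarrow> 'i set \<Rightarrow> ('i \<Rightarrow> 'a \<Rightarrow> real) \<Rightarrow> ('a \<Rightarrow> ereal) \<Rightarrow> bool" where
  "is_ess_inf Pr I f g \<longleftrightarrow>
     g \<in> borel_measurable Pr \<and>
     (\<forall>i\<in>I. AE \<omega> in Pr. g \<omega> \<le> ereal (f i \<omega>)) \<and>
     (\<forall>h \<in> borel_measurable Pr.
        (\<forall>i\<in>I. AE \<omega> in Pr. h \<omega> \<le> ereal (f i \<omega>)) \<longrightarrow> (AE \<omega> in Pr. h \<omega> \<le> g \<omega>))"

text \<open>
  The equation is read in the extended reals, so it forces the essential infimum \<open>g\<close> in the
  driver to be finite almost surely.
\<close>

definition reflected_bsde_solution ::
  "'a measure \<Rightarrow> (nat \<Rightarrow> 'a \<Rightarrow> real ^ 'm) \<Rightarrow> nat \<Rightarrow> 'a measure set \<Rightarrow> (nat \<Rightarrow> 'a \<Rightarrow> real) \<Rightarrow>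
   (nat \<Rightarrow> 'a \<Rightarrow> real) \<Rightarrow> (nat \<Rightarrow> 'a \<Rightarrow> real ^ 'm) \<Rightarrow> (nat \<Rightarrow> 'a \<Rightarrow> real) \<Rightarrow> bool" where
  "reflected_bsde_solution Pr X T \<Lambda> U Y Z K \<longleftrightarrow>
     (\<forall>t\<le>T. Y t \<in> borel_measurable (filt Pr X t) \<and> integrable Pr (Y t)) \<and>
     (\<forall>t<T. Z t \<in> borel_measurable (filt Pr X t) \<and> integrable Pr (Z t)) \<and>
     (\<forall>t\<le>T. K t \<in> borel_measurable (filt Pr X t) \<and> integrable Pr (K t)) \<and>
     (AE \<omega> in Pr. K 0 \<omega> = 0) \<and>
     (\<forall>t<T. AE \<omega> in Pr. K t \<omega> \<le> K (Suc t) \<omega>) \<and>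
     (AE \<omega> in Pr. Y T \<omega> = U T \<omega>) \<and>
     (\<forall>t<T.
        (\<exists>g. is_ess_inf Pr (Theta_set Pr X T \<Lambda>) (\<lambda>\<theta> \<omega>. Z t \<omega> \<bullet> \<theta> t \<omega>) g \<and>
           (AE \<omega> in Pr. ereal (Y t \<omega>) =
              ereal (Y (Suc t) \<omega>) + g \<omega> - ereal (Z t \<omega> \<bullet> mart_diff Pr X (Suc t) \<omega>)
                + ereal (K (Suc t) \<omega> - K t \<omega>))) \<and>
        (AE \<omega> in Pr. Y t \<omega> \<ge> U t \<omega>) \<and>
        (AE \<omega> in Pr. (Y t \<omega> - U t \<omega>) * (K (Suc t) \<omega> - K t \<omega>) = 0))"

text \<open>
  The backward recursion determines \<open>V\<close> up to indistinguishability. No integrability is required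
  of \<open>V\<close>: up to null sets \<open>filt Pr X T\<close> is finite (there are finitely many paths), so adapted
  real-valued processes are integrable under every measure equivalent to \<open>Pr\<close>.
\<close>

definition multiple_prior_snell_envelope ::
  "'a measure \<Rightarrow> (nat \<Rightarrow> 'a \<Rightarrow> real ^ 'm) \<Rightarrow> nat \<Rightarrow> 'a measure set \<Rightarrow> (nat \<Rightarrow> 'a \<Rightarrow> real) \<Rightarrow>
   (nat \<Rightarrow> 'a \<Rightarrow> real) \<Rightarrow> bool" where
  "multiple_prior_snell_envelope Pr X T \<Lambda> U V \<longleftrightarrow>
     (\<forall>t\<le>T. V t \<in> borel_measurable (filt Pr X t)) \<and>
     (AE \<omega> in Pr. V T \<omega> = U T \<omega>) \<and>
     (\<forall>t<T. \<exists>g. is_ess_inf Pr \<Lambda> (\<lambda>Q. real_cond_exp Q (filt Pr X t) (V (Suc t))) g \<and>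
        (AE \<omega> in Pr. ereal (V t \<omega>) = max (ereal (U t \<omega>)) (g \<omega>)))"

end

theory Submission
  imports Defs
begin

text \<open>
  Since \<open>E\<^sup>Q[M\<^bsub>t+1\<^esub> | F\<^sub>t] = \<theta>\<^sub>t\<close> when \<open>Q = Q\<^sup>\<theta>\<close>, conditioning the equation under \<open>Q\<close> gives
  \<open>E\<^sup>Q[Y\<^bsub>t+1\<^esub> | F\<^sub>t] = Y\<^sub>t + (Z\<^sub>t \<bullet> \<theta>\<^sub>t - g) - E\<^sup>Q[K\<^bsub>t+1\<^esub> - K\<^sub>t | F\<^sub>t]\<close>, where \<open>g\<close> is the driver
  \<open>inf\<^sub>\<theta> Z\<^sub>t \<bullet> \<theta>\<^sub>t\<close>. The infimum over \<open>Q\<close> is therefore at most \<open>Y\<^sub>t\<close>, and it equals \<open>Y\<^sub>t\<close> on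
  \<open>{Y\<^sub>t > U\<^sub>t}\<close>, where the increment of \<open>K\<close> vanishes; this is the Snell recursion.

  The pseudoinverse enters only through \<open>\<psi>\<^sub>t \<psi>\<^sub>t\<^sup>+ \<theta>\<^sub>t = \<theta>\<^sub>t\<close>. With \<open>p\<close> the conditional law of
  \<open>X\<^bsub>t+1\<^esub>\<close>, \<open>\<psi>\<^sub>t\<close> is the multinomial covariance \<open>diag p - p p\<^sup>T\<close>, whose range consists of the
  sum-zero vectors supported where \<open>p > 0\<close>. Conversely a prior \<open>Q\<close> with conditional law \<open>q\<close>
  has likelihood ratio \<open>q\<^sub>i / p\<^sub>i\<close> on \<open>{X\<^bsub>t+1\<^esub> = e\<^sub>i}\<close>, so that \<open>Q = Q\<^sup>\<theta>\<close> with \<open>\<theta> = q - p\<close>.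
\<close>

section \<open>The pseudoinverse of a multinomial covariance matrix\<close>

text \<open>\<open>pinv\<close> is a definite description, so a candidate can be used only after
  uniqueness is known. Two solutions \<open>B\<close>, \<open>C\<close> of the Penrose equations
  give the same projections, \<open>A ** C = A ** B\<close> and \<open>C ** A = B ** A\<close>,
  whence \<open>C = C ** A ** C = B ** A ** B = B\<close>.\<close>

lemma pinv_unique:
  fixes A :: "real ^ 'n ^ 'm"
  assumes "A ** B ** A = A" "B ** A ** B = B"
    "transpose (A ** B) = A ** B" "transpose (B ** A) = B ** A"
  shows "pinv A = B"
  unfolding pinv_def
proof (rule the_equality)
  fix C assume C: "A ** C ** A = A \<and> C ** A ** C = C \<and>
    transpose (A ** C) = A ** C \<and> transpose (C ** A) = C ** A"
  have "A ** C = transpose (A ** C)" using C by simp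
  also have "\<dots> = transpose ((A ** B) ** (A ** C))"
    using assms(1) by (simp add: matrix_mul_assoc)
  also have "\<dots> = (A ** C) ** (A ** B)"
    using C assms(3) by (simp add: matrix_transpose_mul)
  also have "\<dots> = A ** B" using C by (simp add: matrix_mul_assoc)
  finally have AC: "A ** C = A ** B" .
  have "C ** A = transpose (C ** A)" using C by simp
  also have "\<dots> = transpose ((C ** A) ** (B ** A))"
    using assms(1) by (metis matrix_mul_assoc)
  also have "\<dots> = (B ** A) ** (C ** A)"
    using C assms(4) by (simp add: matrix_transpose_mul)
  also have "\<dots> = B ** A" using C by (metis matrix_mul_assoc)
  finally have CA: "C ** A = B ** A" .
  have "C = C ** A ** C" using C by simp
  also have "\<dots> = B ** A ** B" using AC CA by (metis matrix_mul_assoc)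
  finally show "C = B" using assms(2) by simp
qed (use assms in auto)

lemma multinomial_cov_pseudoinverse:
  fixes p :: "real ^ 'm" and A :: "real ^ 'm ^ 'm"
  assumes p: "\<And>i. 0 \<le> p $ i" "(\<Sum>i\<in>UNIV. p $ i) = 1"
    and A: "\<And>i j. A $ i $ j = (if i = j then p $ i else 0) - p $ i * p $ j"
  obtains B where "pinv A = B" "A ** B ** A = A"
proof -
  txt \<open>\<open>C\<close> is the orthogonal projection onto the sum-zero vectors supported on \<open>{i. p $ i \<noteq> 0}\<close>,
    and the pseudoinverse of \<open>A\<close> is \<open>C ** R ** C\<close>; \<open>inverse 0 = 0\<close> takes care of the support in \<open>R\<close>.\<close>
  define s where "s i = (if p $ i = 0 then 0 else 1 :: real)" for i
  define k where "k = (\<Sum>i\<in>UNIV. s i)"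
  define C :: "real ^ 'm ^ 'm"
    where "C = (\<chi> i j. (if i = j then s i else 0) - s i * s j / k)"
  define R :: "real ^ 'm ^ 'm" where "R = (\<chi> i j. if i = j then inverse (p $ i) else 0)"
  have ps: "p $ i * s i = p $ i" "s i * s i = s i" "p $ i * inverse (p $ i) = s i" for i
    by (auto simp: s_def)
  \<comment> \<open>\<open>k\<close> is the size of the support of \<open>p\<close>, which is
    non-empty because \<open>p\<close> sums to one. So the division by \<open>k\<close> in
    \<open>C\<close> is a genuine one.\<close>
  have "k \<noteq> 0"
  proof
    assume "k = 0"
    then have "\<forall>i. s i = 0" unfolding k_def by (subst (asm) sum_nonneg_eq_0_iff) (auto simp: s_def)
    then have "\<forall>i. p $ i = 0" by (auto simp: s_def split: if_splits)
    then show False using p(2) by simp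
  qed
  have sym: "transpose A = A" "transpose C = C" "transpose R = R"
    by (auto simp: vec_eq_iff transpose_def A C_def R_def mult.commute)
  have delta: "(\<Sum>l\<in>UNIV. (if i = l then a l else 0) * b l) = a i * b i"
    "(\<Sum>l\<in>UNIV. (if l = i then a l else 0) * b l) = a i * b i"
    "(\<Sum>l\<in>UNIV. b l * (if i = l then a l else 0)) = a i * b i"
    "(\<Sum>l\<in>UNIV. b l * (if l = i then a l else 0)) = a i * b i"
    for i :: 'm and a b :: "'m \<Rightarrow> real"
    by (simp_all add: mult_delta_left mult_delta_right mult.commute)
  have As: "(\<Sum>l\<in>UNIV. A $ i $ l * s l) = 0" for i
    by (simp add: A left_diff_distrib sum_subtractf delta mult.assoc ps sum_distrib_left[symmetric] p)
  have Cs: "(\<Sum>l\<in>UNIV. C $ i $ l * s l) = 0" for i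
  proof -
    have "(\<Sum>l\<in>UNIV. s i * s l / k * s l) = s i / k * (\<Sum>l\<in>UNIV. s l * s l)"
      by (simp add: sum_distrib_left algebra_simps)
    then show ?thesis
      using \<open>k \<noteq> 0\<close> by (simp add: C_def left_diff_distrib sum_subtractf delta ps k_def[symmetric])
  qed
  \<comment> \<open>A matrix whose rows are supported on the support of \<open>p\<close> and have
    sum zero there is fixed by right multiplication with the projection \<open>C\<close>. This
    applies to \<open>A\<close> and to \<open>C\<close> itself.\<close>
  have mulC: "D ** C = D" if "\<And>i. (\<Sum>l\<in>UNIV. D $ i $ l * s l) = 0" "\<And>i j. D $ i $ j * s j = D $ i $ j"
    for D :: "real ^ 'm ^ 'm"
  proof -
    have "(\<Sum>l\<in>UNIV. D $ i $ l * (s l * s j / k)) = (\<Sum>l\<in>UNIV. D $ i $ l * s l) * s j / k" for i j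
      by (simp add: sum_distrib_right sum_divide_distrib mult.assoc)
    moreover have "(\<Sum>l\<in>UNIV. D $ i $ l * (if l = j then s l else 0)) = D $ i $ j" for i j
      by (simp add: mult_delta_right that(2))
    ultimately show ?thesis
      by (simp add: vec_eq_iff matrix_matrix_mult_def C_def right_diff_distrib sum_subtractf that(1))
  qed
  have AC: "A ** C = A"
    by (rule mulC[OF As]) (simp add: s_def A)
  have CC: "C ** C = C"
    by (rule mulC[OF Cs]) (auto simp: s_def C_def)
  have CA: "C ** A = A"
    using AC sym by (metis matrix_transpose_mul)
  have AR: "(A ** R) $ i $ j = (if i = j then s i else 0) - p $ i * s j" for i j
    by (simp add: matrix_matrix_mult_def R_def A left_diff_distrib mult_delta_left mult_delta_right mult.assoc ps)
  \<comment> \<open>\<open>A ** R\<close> is the diagonal matrix of \<open>s\<close> minus the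
    rank-one matrix with entries \<open>p $ i * s j\<close>. The rank-one part is killed by
    \<open>C\<close>, and the diagonal part fixes \<open>C\<close>.\<close>
  have ARC: "A ** R ** C = C"
  proof -
    have sC: "(\<Sum>l\<in>UNIV. s l * C $ l $ j) = 0" for j
      using Cs[of j] sym(2) by (simp add: transpose_def vec_eq_iff mult.commute)
    have "(A ** R ** C) $ i $ j = C $ i $ j" for i j
    proof -
      have "(A ** R ** C) $ i $ j = (\<Sum>l\<in>UNIV. ((if i = l then s i else 0) - p $ i * s l) * C $ l $ j)"
        by (simp add: matrix_matrix_mult_def[of "A ** R"] AR)
      also have "\<dots> = s i * C $ i $ j - p $ i * (\<Sum>l\<in>UNIV. s l * C $ l $ j)"
        by (simp add: left_diff_distrib sum_subtractf mult_delta_left sum_distrib_left mult.assoc)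
      also have "\<dots> = C $ i $ j"
        unfolding sC by (auto simp: C_def s_def)
      finally show ?thesis .
    qed
    then show ?thesis by (simp add: vec_eq_iff)
  qed
  define B where "B = C ** R ** C"
  have AB: "A ** B = C"
    unfolding B_def by (metis AC ARC matrix_mul_assoc)
  have "transpose B = B"
    unfolding B_def by (simp add: matrix_transpose_mul sym matrix_mul_assoc)
  \<comment> \<open>All matrices involved are symmetric, so this is the transpose of
    \<open>AB\<close>.\<close>
  then have BA: "B ** A = C"
    using AB sym by (metis matrix_transpose_mul)
  have "C ** B = B"
    unfolding B_def by (simp add: matrix_mul_assoc CC)
  then have "pinv A = B"
    by (intro pinv_unique) (auto simp: AB BA CA sym)
  then show thesis
    using that AB CA by simp
qed

text \<open>The vector \<theta> lies in the range of \<open>A\<close>: dividing it componentwise by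
  \<open>p\<close> gives a preimage \<open>v\<close>, the correction term vanishing because \<theta>
  sums to zero. Transposing \<open>A ** B ** A = A\<close> shows that the transpose of
  \<open>pinv A\<close> is a generalized inverse too, so it recovers a solution from
  \<open>A *v v\<close>. The transpose occurs because in the density \<theta> stands to the left of
  the pseudoinverse.\<close>

lemma multinomial_cov_solve:
  fixes p \<theta> :: "real ^ 'm" and A :: "real ^ 'm ^ 'm"
  assumes p: "\<And>i. 0 \<le> p $ i" "(\<Sum>i\<in>UNIV. p $ i) = 1"
    and A: "\<And>i j. A $ i $ j = (if i = j then p $ i else 0) - p $ i * p $ j"
    and \<theta>: "(\<Sum>i\<in>UNIV. \<theta> $ i) = 0" "\<And>i. p $ i = 0 \<Longrightarrow> \<theta> $ i = 0"
  shows "A *v (transpose (pinv A) *v \<theta>) = \<theta>"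
proof -
  have sym: "transpose A = A"
    by (auto simp: vec_eq_iff transpose_def A mult.commute)
  obtain B where B: "pinv A = B" "A ** B ** A = A"
    using multinomial_cov_pseudoinverse[OF p A] by blast
  define v :: "real ^ 'm" where "v = (\<chi> i. \<theta> $ i / p $ i)"
  have pv: "p $ i * v $ i = \<theta> $ i" for i
    using \<theta>(2) by (cases "p $ i = 0") (auto simp: v_def)
  have "A *v v = \<theta>"
    by (simp add: vec_eq_iff matrix_vector_mult_def A left_diff_distrib sum_subtractf mult.assoc pv
        sum_distrib_left[symmetric] \<theta> mult_delta_left)
  moreover have "A ** transpose B ** A = A"
    using B(2) sym by (metis matrix_mul_assoc matrix_transpose_mul)
  ultimately show ?thesis
    using B(1) by (metis matrix_vector_mul_assoc)
qed

section \<open>Random variables on finitely many histories\<close>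

text \<open>The functions are arbitrary, since \<open>nn_integral\<close> respects almost sure
  equality without measurability. This allows a density containing \<open>pinv\<close> to be
  replaced by a measurable version.\<close>

lemma density_AE_cong:
  assumes "AE x in M. f x = g x"
  shows "density M f = density M g"
proof -
  have "(\<integral>\<^sup>+ x. f x * indicator A x \<partial>M) = (\<integral>\<^sup>+ x. g x * indicator A x \<partial>M)" for A
    using assms by (intro nn_integral_cong_AE) auto
  then show ?thesis unfolding density_def by simp
qed

lemma borel_measurable_component:
  fixes f :: "'a \<Rightarrow> real ^ 'n"
  assumes "f \<in> borel_measurable N"
  shows "(\<lambda>x. f x $ i) \<in> borel_measurable N"
  using borel_measurable_inner[OF assms borel_measurable_const[of "axis i 1"]]
  by (simp add: inner_axis)

lemma borel_measurable_vecI: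
  fixes f :: "'a \<Rightarrow> real ^ 'n"
  assumes "\<And>i. (\<lambda>x. f x $ i) \<in> borel_measurable N"
  shows "f \<in> borel_measurable N"
  using assms by (subst borel_measurable_euclidean_space) (auto simp: Basis_vec_def inner_axis)

text \<open>Each infimum is a lower bound of the other family, as the two families contain the same
  random variables up to null sets. It serves both to change the version of an infimum and to
  compare two solutions of the Snell recursion.\<close>

lemma is_ess_inf_AE_unique:
  assumes "is_ess_inf M I f g" "is_ess_inf M J f' g'"
    and "\<And>i. i \<in> I \<Longrightarrow> \<exists>j\<in>J. AE x in M. f i x = f' j x"
    and "\<And>j. j \<in> J \<Longrightarrow> \<exists>i\<in>I. AE x in M. f i x = f' j x"
  shows "AE x in M. g x = g' x"
proof -
  have "AE x in M. g x \<le> ereal (f' j x)" if "j \<in> J" for j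
  proof -
    obtain i where i: "i \<in> I" "AE x in M. f i x = f' j x" using assms(4) \<open>j \<in> J\<close> by metis
    moreover have "AE x in M. g x \<le> ereal (f i x)" using assms(1) i unfolding is_ess_inf_def by blast
    ultimately show ?thesis by auto
  qed
  moreover have "AE x in M. g' x \<le> ereal (f i x)" if "i \<in> I" for i
  proof -
    obtain j where j: "j \<in> J" "AE x in M. f i x = f' j x" using assms(3) \<open>i \<in> I\<close> by metis
    moreover have "AE x in M. g' x \<le> ereal (f' j x)" using assms(2) j unfolding is_ess_inf_def by blast
    ultimately show ?thesis by auto
  qed
  ultimately have "AE x in M. g x \<le> g' x" "AE x in M. g' x \<le> g x"
    using assms(1,2) unfolding is_ess_inf_def by blast+
  then show ?thesis by eventually_elim auto
qed

section \<open>The state process, its filtration and its histories\<close>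

locale path_model = prob_space Pr for Pr :: "'a measure" +
  fixes X :: "nat \<Rightarrow> 'a \<Rightarrow> real ^ 'm" and T :: nat
  assumes X_meas: "\<And>t. t \<le> T \<Longrightarrow> X t \<in> borel_measurable Pr"
    and X_range: "\<And>t \<omega>. t \<le> T \<Longrightarrow> \<omega> \<in> space Pr \<Longrightarrow> X t \<omega> \<in> range (\<lambda>i. axis i 1)"
    and sets_Pr: "sets Pr = sets (filt Pr X T)"
    and trivial_start: "\<And>A. A \<in> sets (filt Pr X 0) \<Longrightarrow> measure Pr A = 0 \<or> measure Pr A = 1"
begin

abbreviation nat_filt :: "nat \<Rightarrow> 'a measure" where "nat_filt \<equiv> natural_sigma Pr X"
abbreviation F :: "nat \<Rightarrow> 'a measure" where "F \<equiv> filt Pr X"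
abbreviation M :: "nat \<Rightarrow> 'a \<Rightarrow> real ^ 'm" where "M \<equiv> mart_diff Pr X"

lemma space_nat_filt [simp]: "space (nat_filt t) = space Pr"
  unfolding natural_sigma_def by (auto intro!: space_measure_of)

lemma sets_nat_filt:
  "sets (nat_filt t) = sigma_sets (space Pr) {X s -` B \<inter> space Pr | s B. s \<le> t \<and> B \<in> sets borel}"
  unfolding natural_sigma_def by (auto intro!: sets_measure_of)

lemma nat_filt_mono: "s \<le> t \<Longrightarrow> sets (nat_filt s) \<subseteq> sets (nat_filt t)"
  unfolding sets_nat_filt by (rule sigma_sets_mono') fastforce

lemma subalgebra_nat_filt: "t \<le> T \<Longrightarrow> subalgebra Pr (nat_filt t)"
  unfolding subalgebra_def sets_nat_filt space_nat_filt
  by (auto intro!: sets.sigma_sets_subset measurable_sets[OF X_meas])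

lemma X_nat_filt: "s \<le> t \<Longrightarrow> X s \<in> borel_measurable (nat_filt t)"
  by (rule measurableI) (auto simp: sets_nat_filt intro!: sigma_sets.Basic)

lemma space_F [simp]: "space (F t) = space Pr"
  unfolding filt_def by (simp add: space_restr_to_subalg)

lemma F_mono:
  assumes "s \<le> t" "t \<le> T"
  shows "sets (F s) \<subseteq> sets (F t)"
proof
  fix A assume "A \<in> sets (F s)"
  then obtain S N N' where "A = S \<union> N" "N \<subseteq> N'"
    "N' \<in> null_sets (restr_to_subalg Pr (nat_filt s))" "S \<in> sets (restr_to_subalg Pr (nat_filt s))"
    unfolding filt_def by (rule sets_completionE)
  moreover from this have "N' \<in> null_sets (restr_to_subalg Pr (nat_filt t))"
    "S \<in> sets (restr_to_subalg Pr (nat_filt t))"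
    using nat_filt_mono[OF assms(1)] subalgebra_nat_filt[of s] subalgebra_nat_filt[of t] assms
    by (auto simp: null_sets_restr_to_subalg sets_restr_to_subalg)
  ultimately show "A \<in> sets (F t)"
    unfolding filt_def by (intro sets_completionI[of A S N N'])
qed

lemma subalgebra_F: "t \<le> T \<Longrightarrow> subalgebra Pr (F t)"
  using F_mono[of t T] sets_Pr by (simp add: subalgebra_def)

lemma measurable_nat_filt_F:
  assumes "t \<le> T" "f \<in> measurable (nat_filt t) N"
  shows "f \<in> measurable (F t) N"
  unfolding filt_def
  by (rule measurable_completion) (rule measurable_in_subalg[OF subalgebra_nat_filt[OF assms(1)] assms(2)])

lemma measurable_F_mono: "s \<le> t \<Longrightarrow> t \<le> T \<Longrightarrow> f \<in> measurable (F s) N \<Longrightarrow> f \<in> measurable (F t) N"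
  by (rule measurable_from_subalg[of "F t" "F s"]) (auto simp: subalgebra_def dest: F_mono)

lemma measurable_F_Pr: "t \<le> T \<Longrightarrow> f \<in> measurable (F t) N \<Longrightarrow> f \<in> measurable Pr N"
  by (rule measurable_from_subalg[OF subalgebra_F])

lemma measurable_Pr_F_T: "f \<in> measurable Pr N \<longleftrightarrow> f \<in> measurable (F T) N"
  using sets_Pr by (intro arg_cong[where f = "\<lambda>S. f \<in> S"] measurable_cong_sets) auto

lemma X_F: "s \<le> t \<Longrightarrow> t \<le> T \<Longrightarrow> X s \<in> borel_measurable (F t)"
  by (intro measurable_nat_filt_F X_nat_filt)

text \<open>The restriction makes the path extensional, so that the possible values form the finite
  set \<open>histories t\<close> and equality of histories means equality of the states up to time
  \<open>t\<close>.\<close>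

definition history :: "nat \<Rightarrow> 'a \<Rightarrow> nat \<Rightarrow> real ^ 'm" where
  "history t \<omega> = restrict (\<lambda>s. X s \<omega>) {..t}"

definition histories :: "nat \<Rightarrow> (nat \<Rightarrow> real ^ 'm) set" where
  "histories t = PiE {..t} (\<lambda>_. range (\<lambda>i. axis i 1))"

lemma finite_histories: "finite (histories t)"
  unfolding histories_def by (auto intro!: finite_PiE)

lemma history_in_histories: "t \<le> T \<Longrightarrow> \<omega> \<in> space Pr \<Longrightarrow> history t \<omega> \<in> histories t"
  unfolding history_def histories_def using X_range[of _ \<omega>] by auto

lemma history_Suc: "history (Suc t) \<omega> = (history t \<omega>)(Suc t := X (Suc t) \<omega>)"
  unfolding history_def by (auto simp: fun_eq_iff)

lemma history_level_set: "{\<omega> \<in> space Pr. history t \<omega> = p} \<in> sets (nat_filt t)"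
proof (cases "p \<in> extensional {..t}")
  case True
  then have "{\<omega> \<in> space Pr. history t \<omega> = p} = {\<omega> \<in> space (nat_filt t). \<forall>s\<in>{..t}. X s \<omega> = p s}"
    by (auto simp: history_def fun_eq_iff extensional_def)
  also have "\<dots> \<in> sets (nat_filt t)"
  proof (intro sets.sets_Collect_finite_All)
    fix s assume "s \<in> {..t}"
    then have [measurable]: "X s \<in> borel_measurable (nat_filt t)" by (intro X_nat_filt) auto
    show "{\<omega> \<in> space (nat_filt t). X s \<omega> = p s} \<in> sets (nat_filt t)" by measurable
  qed auto
  finally show ?thesis .
next
  case False
  then have "{\<omega> \<in> space Pr. history t \<omega> = p} = {}"
    by (auto simp: history_def)
  then show ?thesis by (metis sets.empty_sets)
qed

text \<open>Every preimage is a finite union of level sets of the history, whatever \<open>G\<close>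
  is. Thus expressions built with \<open>pinv\<close> or with infima over arbitrary families become
  measurable as soon as they are written in terms of the history.\<close>

lemma measurable_of_history:
  assumes "t \<le> T" "\<And>p. G p \<in> space N"
  shows "(\<lambda>\<omega>. G (history t \<omega>)) \<in> measurable (nat_filt t) N"
proof (rule measurableI)
  fix B
  have "(\<lambda>\<omega>. G (history t \<omega>)) -` B \<inter> space (nat_filt t)
      = (\<Union>p\<in>{p \<in> histories t. G p \<in> B}. {\<omega> \<in> space Pr. history t \<omega> = p})"
    using history_in_histories[OF assms(1)] by auto
  also have "\<dots> \<in> sets (nat_filt t)"
    using finite_histories history_level_set by (intro sets.finite_UN) auto
  finally show "(\<lambda>\<omega>. G (history t \<omega>)) -` B \<inter> space (nat_filt t) \<in> sets (nat_filt t)" .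
qed (use assms in auto)

lemma measurable_of_history_F:
  assumes "t \<le> T" "\<And>p. G p \<in> space N"
  shows "(\<lambda>\<omega>. G (history t \<omega>)) \<in> measurable (F t) N"
  using assms by (intro measurable_nat_filt_F measurable_of_history)

text \<open>The generators depend only on the states up to time \<open>t\<close>, and invariance
  survives complements and countable unions. So the level sets of the history are the atoms of
  \<open>nat_filt t\<close>.\<close>

lemma nat_filt_history_invariant:
  assumes "A \<in> sets (nat_filt t)" "\<omega> \<in> space Pr" "\<omega>' \<in> space Pr" "history t \<omega> = history t \<omega>'"
  shows "\<omega> \<in> A \<longleftrightarrow> \<omega>' \<in> A"
  using assms(1) unfolding sets_nat_filt
proof (induction rule: sigma_sets.induct)
  case (Basic a)
  then obtain s B where "s \<le> t" "a = X s -` B \<inter> space Pr" by blast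
  moreover have "X s \<omega> = X s \<omega>'"
    using fun_cong[OF assms(4), of s] \<open>s \<le> t\<close> by (simp add: history_def)
  ultimately show ?case using assms by auto
qed (use assms in auto)

text \<open>A random variable measurable for the completion has a version measurable for the
  uncompleted algebra, and that version is constant on the atoms.\<close>

lemma AE_function_of_history:
  fixes f :: "'a \<Rightarrow> real"
  assumes "t \<le> T" "f \<in> borel_measurable (F t)"
  obtains G where "AE \<omega> in Pr. f \<omega> = G (history t \<omega>)"
proof -
  obtain f' where f': "f' \<in> borel_measurable (restr_to_subalg Pr (nat_filt t))"
    "AE \<omega> in restr_to_subalg Pr (nat_filt t). f \<omega> = f' \<omega>"
    using completion_ex_borel_measurable_real assms(2) unfolding filt_def by blast
  have m: "f' \<in> borel_measurable (nat_filt t)"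
    using f'(1) measurable_in_subalg'[OF subalgebra_nat_filt[OF assms(1)]] by blast
  \<comment> \<open>\<open>G\<close> evaluates the version at a chosen representative of the
    history; at paths that never occur its value is arbitrary.\<close>
  define G where "G p = f' (SOME \<omega>. \<omega> \<in> space Pr \<and> history t \<omega> = p)" for p
  have "f' \<omega> = G (history t \<omega>)" if "\<omega> \<in> space Pr" for \<omega>
  proof -
    define \<omega>' where "\<omega>' = (SOME \<omega>'. \<omega>' \<in> space Pr \<and> history t \<omega>' = history t \<omega>)"
    have \<omega>': "\<omega>' \<in> space Pr \<and> history t \<omega>' = history t \<omega>"
      unfolding \<omega>'_def by (rule someI) (use that in auto)
    have "f' -` {f' \<omega>} \<inter> space (nat_filt t) \<in> sets (nat_filt t)"
      using m by (rule measurable_sets) auto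
    then show ?thesis
      using nat_filt_history_invariant[of "f' -` {f' \<omega>} \<inter> space (nat_filt t)" t \<omega> \<omega>'] \<omega>' that
      unfolding G_def \<omega>'_def[symmetric] by auto
  qed
  with AE_restr_to_subalg[OF subalgebra_nat_filt[OF assms(1)] f'(2)]
  have "AE \<omega> in Pr. f \<omega> = G (history t \<omega>)" by (auto elim: AE_mp)
  then show thesis by (rule that)
qed

lemma AE_function_of_history_vec:
  fixes f :: "'a \<Rightarrow> real ^ 'n"
  assumes "t \<le> T" "f \<in> borel_measurable (F t)"
  obtains G where "AE \<omega> in Pr. f \<omega> = G (history t \<omega>)"
proof -
  have "\<exists>G. AE \<omega> in Pr. f \<omega> $ i = G (history t \<omega>)" for i
  proof -
    have "(\<lambda>\<omega>. f \<omega> $ i) \<in> borel_measurable (F t)" using assms(2) by (rule borel_measurable_component)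
    from AE_function_of_history[OF assms(1) this] show ?thesis by metis
  qed
  then obtain G where "\<And>i. AE \<omega> in Pr. f \<omega> $ i = G i (history t \<omega>)" by metis
  then have "AE \<omega> in Pr. \<forall>i. f \<omega> $ i = G i (history t \<omega>)"
    by (simp add: AE_all_countable)
  then have "AE \<omega> in Pr. f \<omega> = (\<lambda>p. \<chi> i. G i p) (history t \<omega>)"
    by eventually_elim (auto simp: vec_eq_iff)
  then show thesis by (rule that)
qed

text \<open>Since there are only finitely many histories, every random variable is essentially bounded, so
  integrability is automatic under every measure equivalent to \<open>Pr\<close>.\<close>

lemma integrable_equiv:
  fixes f :: "'a \<Rightarrow> real"
  assumes "prob_space Q" "sets Q = sets Pr" "absolutely_continuous Pr Q" "f \<in> borel_measurable Pr"
  shows "integrable Q f"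
proof -
  interpret Q: prob_space Q by fact
  have "f \<in> borel_measurable (F T)" using assms(4) measurable_Pr_F_T by blast
  then obtain G where G: "AE \<omega> in Pr. f \<omega> = G (history T \<omega>)" using AE_function_of_history by blast
  have "AE \<omega> in Pr. norm (f \<omega>) \<le> (\<Sum>p\<in>histories T. \<bar>G p\<bar>)"
    using G AE_space
  proof eventually_elim
    case (elim \<omega>)
    then show ?case
      using member_le_sum[of "history T \<omega>" "histories T" "\<lambda>p. \<bar>G p\<bar>"] history_in_histories[of T \<omega>] finite_histories by auto
  qed
  then have "AE \<omega> in Q. norm (f \<omega>) \<le> (\<Sum>p\<in>histories T. \<bar>G p\<bar>)"
    using absolutely_continuous_AE[OF assms(2,3)] by blast
  moreover have "f \<in> borel_measurable Q"
    using assms(4) measurable_cong_sets[OF assms(2) refl] by blast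
  ultimately show ?thesis by (rule Q.integrable_const_bound)
qed

lemma integrable_Pr: "f \<in> borel_measurable Pr \<Longrightarrow> integrable Pr (f :: 'a \<Rightarrow> real)"
  by (rule integrable_equiv) (auto simp: absolutely_continuous_def prob_space_axioms)

lemma X_decompose:
  assumes "t \<le> T" "\<omega> \<in> space Pr"
  obtains i where "X t \<omega> = axis i 1" "\<forall>j. X t \<omega> $ j = (if j = i then 1 else 0)"
proof -
  obtain i where i: "X t \<omega> = axis i 1" using X_range[OF assms] by auto
  then have "\<forall>j. X t \<omega> $ j = (if j = i then 1 else 0)" by (simp add: axis_def)
  with i show thesis by (rule that)
qed

text \<open>\<open>h i\<close> is the value that \<open>f\<close> takes when the history up to
  \<open>t\<close> is continued by the state \<open>axis i 1\<close>; the coordinates of the next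
  state select the right summand. This separates known coefficients from the one new random
  input.\<close>

lemma decompose_next_step:
  fixes f :: "'a \<Rightarrow> real"
  assumes "Suc t \<le> T" "f \<in> borel_measurable (F (Suc t))"
  obtains h where "\<And>i. h i \<in> borel_measurable (F t)"
    "AE \<omega> in Pr. f \<omega> = (\<Sum>i\<in>UNIV. h i \<omega> * X (Suc t) \<omega> $ i)"
proof -
  obtain G where G: "AE \<omega> in Pr. f \<omega> = G (history (Suc t) \<omega>)"
    using AE_function_of_history[OF assms] .
  define h where "h i \<omega> = (\<lambda>p. G (p(Suc t := axis i 1))) (history t \<omega>)" for i :: 'm and \<omega>
  have "h i \<in> borel_measurable (F t)" for i
    unfolding h_def using assms(1) by (intro measurable_of_history_F) auto
  moreover have "AE \<omega> in Pr. f \<omega> = (\<Sum>i\<in>UNIV. h i \<omega> * X (Suc t) \<omega> $ i)"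
    using G AE_space
  proof eventually_elim
    case (elim \<omega>)
    obtain i where "X (Suc t) \<omega> = axis i 1" "\<forall>j. X (Suc t) \<omega> $ j = (if j = i then 1 else 0)"
      using X_decompose[OF assms(1) elim(2)] .
    then show ?case
      using elim(1) by (simp add: history_Suc h_def mult_delta_right)
  qed
  ultimately show thesis by (rule that)
qed

text \<open>The essential infimum is the pointwise infimum over the index set, taken history by
  history. Besides existence this yields an adapted version, whereas \<open>is_ess_inf\<close>
  itself asks only for measurability with respect to \<open>Pr\<close>.\<close>

lemma ess_inf_exists:
  fixes f :: "'i \<Rightarrow> 'a \<Rightarrow> real"
  assumes "t \<le> T" "I \<noteq> {}" "\<And>i. i \<in> I \<Longrightarrow> f i \<in> borel_measurable (F t)"
  obtains g where "g \<in> borel_measurable (F t)" "is_ess_inf Pr I f g"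
proof -
  have "\<forall>i. \<exists>G. i \<in> I \<longrightarrow> (AE \<omega> in Pr. f i \<omega> = G (history t \<omega>))"
    using AE_function_of_history[OF assms(1) assms(3)] by metis
  then obtain G where G: "\<And>i. i \<in> I \<Longrightarrow> AE \<omega> in Pr. f i \<omega> = G i (history t \<omega>)" by metis
  define e where "e p = (INF i\<in>I. ereal (G i p))" for p
  have meas: "(\<lambda>\<omega>. e (history t \<omega>)) \<in> borel_measurable (F t)"
    using assms(1) by (intro measurable_of_history_F) auto
  \<comment> \<open>The index set may be uncountable, so almost sure bounds cannot be combined over
    all of it. For each history a countable subfamily already has the same infimum, and there are
    finitely many histories.\<close>
  have "\<exists>J. countable J \<and> J \<subseteq> I \<and> e p = (INF i\<in>J. ereal (G i p))" for p
  proof -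
    obtain \<phi> :: "nat \<Rightarrow> ereal" where \<phi>: "range \<phi> \<subseteq> (\<lambda>i. ereal (G i p)) ` I" "e p = (INF n. \<phi> n)"
      using Inf_countable_INF[of "(\<lambda>i. ereal (G i p)) ` I"] assms(2) unfolding e_def by auto
    obtain J where J: "countable J" "J \<subseteq> I" "range \<phi> = (\<lambda>i. ereal (G i p)) ` J"
      using countable_subset_image[of "range \<phi>" "\<lambda>i. ereal (G i p)" I] \<phi>(1) by auto
    then show ?thesis using \<phi>(2) by metis
  qed
  then obtain J where J: "\<And>p. countable (J p)" "\<And>p. J p \<subseteq> I"
    "\<And>p. e p = (INF i\<in>J p. ereal (G i p))" by metis
  have "is_ess_inf Pr I f (\<lambda>\<omega>. e (history t \<omega>))"
    unfolding is_ess_inf_def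
  proof (intro conjI ballI impI)
    show "(\<lambda>\<omega>. e (history t \<omega>)) \<in> borel_measurable Pr"
      using measurable_F_Pr[OF assms(1) meas] .
    show "AE \<omega> in Pr. e (history t \<omega>) \<le> ereal (f i \<omega>)" if "i \<in> I" for i
      using G[OF that] by eventually_elim (auto simp: e_def intro!: INF_lower that)
    fix h :: "'a \<Rightarrow> ereal"
    assume h: "\<forall>i\<in>I. AE \<omega> in Pr. h \<omega> \<le> ereal (f i \<omega>)"
    have "AE \<omega> in Pr. \<forall>p\<in>histories t. \<forall>i\<in>J p. h \<omega> \<le> ereal (G i (history t \<omega>))"
    proof (rule AE_ball_countable'[OF _ countable_finite[OF finite_histories]],
        rule AE_ball_countable'[OF _ J(1)])
      fix p i assume "i \<in> J p"
      then have "i \<in> I" using J(2) by blast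
      show "AE \<omega> in Pr. h \<omega> \<le> ereal (G i (history t \<omega>))"
        using G[OF \<open>i \<in> I\<close>] h[rule_format, OF \<open>i \<in> I\<close>] by eventually_elim auto
    qed
    then show "AE \<omega> in Pr. h \<omega> \<le> e (history t \<omega>)"
      using AE_space
    proof eventually_elim
      case (elim \<omega>)
      then show ?case
        using history_in_histories[OF assms(1), of \<omega>] by (subst J(3)) (auto intro!: INF_greatest)
    qed
  qed
  with meas show thesis by (rule that)
qed

section \<open>Conditional expectations under equivalent measures\<close>

definition equiv_prob :: "'a measure \<Rightarrow> bool" where
  "equiv_prob Q \<longleftrightarrow> prob_space Q \<and> sets Q = sets Pr \<and> absolutely_continuous Pr Q \<and> absolutely_continuous Q Pr"

lemma equiv_prob_Pr: "equiv_prob Pr"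
  by (simp add: equiv_prob_def prob_space_axioms absolutely_continuous_def)

lemma equiv_prob_AE:
  assumes "equiv_prob Q"
  shows "(AE \<omega> in Q. P \<omega>) \<longleftrightarrow> (AE \<omega> in Pr. P \<omega>)"
  using assms absolutely_continuous_AE unfolding equiv_prob_def by metis

lemma equiv_prob_space: "equiv_prob Q \<Longrightarrow> space Q = space Pr"
  unfolding equiv_prob_def by (auto dest: sets_eq_imp_space_eq)

lemma equiv_prob_measurable: "equiv_prob Q \<Longrightarrow> f \<in> measurable Q N \<longleftrightarrow> f \<in> measurable Pr N"
  unfolding equiv_prob_def using measurable_cong_sets[of Q Pr N N] by auto

lemma equiv_prob_integrable: "equiv_prob Q \<Longrightarrow> f \<in> borel_measurable Pr \<Longrightarrow> integrable Q (f :: 'a \<Rightarrow> real)"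
  unfolding equiv_prob_def by (intro integrable_equiv) auto

lemma equiv_prob_subalgebra:
  assumes "equiv_prob Q" "t \<le> T"
  shows "finite_measure_subalgebra Q (F t)"
proof -
  interpret Q: prob_space Q using assms(1) unfolding equiv_prob_def by blast
  show ?thesis
    by standard (use subalgebra_F[OF assms(2)] assms(1) equiv_prob_space in \<open>auto simp: subalgebra_def equiv_prob_def\<close>)
qed

lemma cond_exp_intg:
  assumes "equiv_prob Q" "t \<le> T" "f \<in> borel_measurable (F t)" "g \<in> borel_measurable Pr"
  shows "(\<integral>\<omega>. f \<omega> * real_cond_exp Q (F t) g \<omega> \<partial>Q) = (\<integral>\<omega>. f \<omega> * g \<omega> \<partial>Q)"
proof -
  interpret Q: finite_measure_subalgebra Q "F t" by (rule equiv_prob_subalgebra) fact+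
  have "f \<in> borel_measurable Pr" using assms by (auto intro: measurable_F_Pr)
  then show ?thesis
    using assms by (intro Q.real_cond_exp_intg equiv_prob_integrable) (auto simp: equiv_prob_measurable)
qed

text \<open>Conditional expectations are identified by integrating against all adapted
  \<open>h\<close>; no boundedness of \<open>h\<close> is needed because all random variables are
  essentially bounded.\<close>

lemma cond_exp_characterization:
  assumes "equiv_prob Q" "t \<le> T" "f \<in> borel_measurable Pr" "g \<in> borel_measurable (F t)"
    and "\<And>h. h \<in> borel_measurable (F t) \<Longrightarrow> (\<integral>\<omega>. h \<omega> * f \<omega> \<partial>Q) = (\<integral>\<omega>. h \<omega> * g \<omega> \<partial>Q)"
  shows "AE \<omega> in Pr. real_cond_exp Q (F t) f \<omega> = g \<omega>"
proof -
  interpret Q: finite_measure_subalgebra Q "F t" by (rule equiv_prob_subalgebra) fact+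
  have "g \<in> borel_measurable Pr" using assms by (auto intro: measurable_F_Pr)
  then have "AE \<omega> in Q. real_cond_exp Q (F t) f \<omega> = g \<omega>"
    using assms by (intro Q.real_cond_exp_charact equiv_prob_integrable)
      (auto simp: set_lebesgue_integral_def)
  then show ?thesis using assms(1) equiv_prob_AE by blast
qed

section \<open>One-step conditional laws of the state process\<close>

lemma X_component: "s \<le> t \<Longrightarrow> t \<le> T \<Longrightarrow> (\<lambda>\<omega>. X s \<omega> $ i) \<in> borel_measurable (F t)"
  by (intro borel_measurable_component X_F)

lemma X_component_Pr [measurable]: "s \<le> T \<Longrightarrow> (\<lambda>\<omega>. X s \<omega> $ i) \<in> borel_measurable Pr"
  by (intro borel_measurable_component X_meas)

text \<open>Coordinate \<open>i\<close> of a basis vector is the indicator of its being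
  \<open>axis i 1\<close>, so this conditional mean is the conditional law of the next state under
  \<open>Q\<close>.\<close>

definition step_prob :: "'a measure \<Rightarrow> nat \<Rightarrow> 'a \<Rightarrow> real ^ 'm" where
  "step_prob Q t = vec_cond_exp Q (F t) (X (Suc t))"

lemma step_prob_component: "step_prob Q t \<omega> $ i = real_cond_exp Q (F t) (\<lambda>\<omega>. X (Suc t) \<omega> $ i) \<omega>"
  by (simp add: step_prob_def vec_cond_exp_def)

lemma step_prob_measurable [measurable]: "(\<lambda>\<omega>. step_prob Q t \<omega> $ i) \<in> borel_measurable (F t)"
  unfolding step_prob_component by simp

lemma step_prob_intg:
  assumes "equiv_prob Q" "Suc t \<le> T" "f \<in> borel_measurable (F t)"
  shows "(\<integral>\<omega>. f \<omega> * X (Suc t) \<omega> $ i \<partial>Q) = (\<integral>\<omega>. f \<omega> * step_prob Q t \<omega> $ i \<partial>Q)"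
  using assms unfolding step_prob_component by (subst cond_exp_intg) auto

lemma mart_diff_component: "M (Suc t) \<omega> $ i = X (Suc t) \<omega> $ i - step_prob Pr t \<omega> $ i"
  by (simp add: mart_diff_def step_prob_def)

lemma mart_diff_measurable:
  assumes "Suc t \<le> T"
  shows "(\<lambda>\<omega>. M (Suc t) \<omega> $ i) \<in> borel_measurable (F (Suc t))"
proof -
  have "(\<lambda>\<omega>. step_prob Pr t \<omega> $ i) \<in> borel_measurable (F (Suc t))"
    by (rule measurable_F_mono[OF _ assms step_prob_measurable]) simp
  then show ?thesis
    unfolding mart_diff_component using X_component[OF order_refl assms] by simp
qed

lemma step_prob_simplex:
  assumes "equiv_prob Q" "Suc t \<le> T"
  shows "AE \<omega> in Pr. (\<forall>i. 0 \<le> step_prob Q t \<omega> $ i) \<and> (\<Sum>i\<in>UNIV. step_prob Q t \<omega> $ i) = 1"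
proof -
  interpret Q: finite_measure_subalgebra Q "F t" by (rule equiv_prob_subalgebra) (use assms in auto)
  have m: "(\<lambda>\<omega>. X (Suc t) \<omega> $ i) \<in> borel_measurable Q" for i
    using assms by (simp add: equiv_prob_measurable)
  have int: "integrable Q (\<lambda>\<omega>. X (Suc t) \<omega> $ i)" for i
    using assms by (intro equiv_prob_integrable) auto
  have X: "(\<forall>i. 0 \<le> X (Suc t) \<omega> $ i) \<and> (\<Sum>i\<in>UNIV. X (Suc t) \<omega> $ i) = 1" if "\<omega> \<in> space Pr" for \<omega>
  proof -
    obtain i where "\<forall>j. X (Suc t) \<omega> $ j = (if j = i then 1 else 0)"
      using X_decompose[OF assms(2) \<open>\<omega> \<in> space Pr\<close>] by metis
    then show ?thesis by simp
  qed
  have "AE \<omega> in Q. 0 \<le> step_prob Q t \<omega> $ i" for i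
    unfolding step_prob_component
    by (intro Q.real_cond_exp_pos AE_I2) (use X m equiv_prob_space[OF assms(1)] in auto)
  then have nonneg: "AE \<omega> in Pr. \<forall>i. 0 \<le> step_prob Q t \<omega> $ i"
    by (simp add: AE_all_countable equiv_prob_AE[OF assms(1)])
  have "AE \<omega> in Q. real_cond_exp Q (F t) (\<lambda>\<omega>. \<Sum>i\<in>UNIV. X (Suc t) \<omega> $ i) \<omega>
      = (\<Sum>i\<in>UNIV. step_prob Q t \<omega> $ i)"
    unfolding step_prob_component by (rule Q.real_cond_exp_sum[OF int])
  moreover have "AE \<omega> in Q. real_cond_exp Q (F t) (\<lambda>\<omega>. \<Sum>i\<in>UNIV. X (Suc t) \<omega> $ i) \<omega>
      = real_cond_exp Q (F t) (\<lambda>\<omega>. 1) \<omega>"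
    by (intro Q.real_cond_exp_cong AE_I2) (use X m equiv_prob_space[OF assms(1)] in auto)
  moreover have "AE \<omega> in Q. real_cond_exp Q (F t) (\<lambda>\<omega>. 1) \<omega> = 1"
    by (rule Q.real_cond_exp_F_meas) auto
  ultimately have "AE \<omega> in Q. (\<Sum>i\<in>UNIV. step_prob Q t \<omega> $ i) = 1"
    by eventually_elim auto
  with nonneg show ?thesis by (simp add: equiv_prob_AE[OF assms(1)])
qed

text \<open>Over the \<open>F t\<close>-event where the conditional probability of state
  \<open>i\<close> is zero, the coordinate \<open>i\<close> of the next state has the same integral
  as that probability, namely zero, and it is non-negative.\<close>

lemma X_zero_off_support:
  assumes "Suc t \<le> T"
  shows "AE \<omega> in Pr. \<forall>i. step_prob Pr t \<omega> $ i = 0 \<longrightarrow> X (Suc t) \<omega> $ i = 0"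
proof -
  have "AE \<omega> in Pr. step_prob Pr t \<omega> $ i = 0 \<longrightarrow> X (Suc t) \<omega> $ i = 0" for i
  proof -
    define f where "f \<omega> = (if step_prob Pr t \<omega> $ i = 0 then 1 else 0 :: real)" for \<omega>
    have f: "f \<in> borel_measurable (F t)" unfolding f_def by measurable
    then have fX: "(\<lambda>\<omega>. f \<omega> * X (Suc t) \<omega> $ i) \<in> borel_measurable Pr"
      using measurable_F_Pr[OF _ f] assms by (intro borel_measurable_times) auto
    have "(\<integral>\<omega>. f \<omega> * X (Suc t) \<omega> $ i \<partial>Pr) = (\<integral>\<omega>. 0 \<partial>Pr)"
      unfolding step_prob_intg[OF equiv_prob_Pr assms f]
      by (intro Bochner_Integration.integral_cong) (auto simp: f_def)
    then have "(\<integral>\<omega>. f \<omega> * X (Suc t) \<omega> $ i \<partial>Pr) = 0" by simp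
    then have "AE \<omega> in Pr. f \<omega> * X (Suc t) \<omega> $ i = 0"
    proof (subst (asm) integral_nonneg_eq_0_iff_AE)
      show "AE \<omega> in Pr. 0 \<le> f \<omega> * X (Suc t) \<omega> $ i"
      proof (rule AE_I2)
        fix \<omega> assume "\<omega> \<in> space Pr"
        then obtain k where "\<forall>j. X (Suc t) \<omega> $ j = (if j = k then 1 else 0)"
          using X_decompose[OF assms] by metis
        then show "0 \<le> f \<omega> * X (Suc t) \<omega> $ i" by (simp add: f_def)
      qed
    qed (use integrable_Pr[OF fX] in auto)
    then show ?thesis by eventually_elim (auto simp: f_def)
  qed
  then show ?thesis by (simp add: AE_all_countable)
qed

text \<open>Equivalence of the measures is passed on to the one-step laws: where state
  \<open>i\<close> has conditional probability zero under \<open>Pr\<close>, it is not reached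
  \<open>Pr\<close>-a.s., hence not \<open>Q\<close>-a.s., and so its \<open>Q\<close>-conditional
  probability integrates to zero. This makes the ratios of the two laws meaningful.\<close>

lemma step_prob_zero_off_support:
  assumes "equiv_prob Q" "Suc t \<le> T"
  shows "AE \<omega> in Pr. \<forall>i. step_prob Pr t \<omega> $ i = 0 \<longrightarrow> step_prob Q t \<omega> $ i = 0"
proof -
  have "AE \<omega> in Pr. step_prob Pr t \<omega> $ i = 0 \<longrightarrow> step_prob Q t \<omega> $ i = 0" for i
  proof -
    define f where "f \<omega> = (if step_prob Pr t \<omega> $ i = 0 then 1 else 0 :: real)" for \<omega>
    have f: "f \<in> borel_measurable (F t)" unfolding f_def by measurable
    have fq: "(\<lambda>\<omega>. f \<omega> * step_prob Q t \<omega> $ i) \<in> borel_measurable Pr"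
      using assms f by (intro measurable_F_Pr[of t] borel_measurable_times) auto
    have "AE \<omega> in Q. f \<omega> * X (Suc t) \<omega> $ i = 0"
      unfolding equiv_prob_AE[OF assms(1)]
      using X_zero_off_support[OF assms(2)] by eventually_elim (auto simp: f_def)
    then have "(\<integral>\<omega>. f \<omega> * step_prob Q t \<omega> $ i \<partial>Q) = 0"
      unfolding step_prob_intg[OF assms f, symmetric] by (rule integral_eq_zero_AE)
    then have "AE \<omega> in Q. f \<omega> * step_prob Q t \<omega> $ i = 0"
    proof (subst (asm) integral_nonneg_eq_0_iff_AE)
      show "AE \<omega> in Q. 0 \<le> f \<omega> * step_prob Q t \<omega> $ i"
        unfolding equiv_prob_AE[OF assms(1)]
        using step_prob_simplex[OF assms] by eventually_elim (auto simp: f_def)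
    qed (use equiv_prob_integrable[OF assms(1) fq] in auto)
    then show ?thesis
      unfolding equiv_prob_AE[OF assms(1)] by eventually_elim (auto simp: f_def)
  qed
  then show ?thesis by (simp add: AE_all_countable)
qed

lemma reachable_iff:
  assumes "Suc t \<le> T"
  shows "AE \<omega> in Pr. \<forall>i. i \<in> reachable Pr X t \<omega> \<longleftrightarrow> 0 < step_prob Pr t \<omega> $ i"
proof -
  interpret P: finite_measure_subalgebra Pr "F t"
    using equiv_prob_subalgebra[OF equiv_prob_Pr, of t] assms by simp
  have "AE \<omega> in Pr. i \<in> reachable Pr X t \<omega> \<longleftrightarrow> 0 < step_prob Pr t \<omega> $ i" for i
  proof -
    have eq: "indicator {\<omega>' \<in> space Pr. X (Suc t) \<omega>' = axis i 1} \<omega> = X (Suc t) \<omega> $ i"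
      if "\<omega> \<in> space Pr" for \<omega>
    proof -
      obtain k where k: "X (Suc t) \<omega> = axis k 1" "\<forall>j. X (Suc t) \<omega> $ j = (if j = k then 1 else 0)"
        using X_decompose[OF assms \<open>\<omega> \<in> space Pr\<close>] .
      then show ?thesis using that by (auto simp: axis_eq_axis)
    qed
    have m: "(\<lambda>\<omega>. X (Suc t) \<omega> $ i) \<in> borel_measurable Pr" using assms by simp
    moreover have "(indicator {\<omega>' \<in> space Pr. X (Suc t) \<omega>' = axis i 1} :: 'a \<Rightarrow> real) \<in> borel_measurable Pr
        \<longleftrightarrow> (\<lambda>\<omega>. X (Suc t) \<omega> $ i) \<in> borel_measurable Pr"
      by (rule measurable_cong) (rule eq)
    ultimately have "AE \<omega> in Pr. real_cond_exp Pr (F t) (indicator {\<omega>' \<in> space Pr. X (Suc t) \<omega>' = axis i 1}) \<omega>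
        = step_prob Pr t \<omega> $ i"
      unfolding step_prob_component by (intro P.real_cond_exp_cong AE_I2 eq) auto
    then show ?thesis by eventually_elim (simp add: reachable_def)
  qed
  then show ?thesis by (simp add: AE_all_countable)
qed

section \<open>Martingale differences and their conditional covariance\<close>

lemma mart_diff_intg_zero:
  assumes "Suc t \<le> T" "f \<in> borel_measurable (F t)"
  shows "(\<integral>\<omega>. f \<omega> * M (Suc t) \<omega> $ i \<partial>Pr) = 0"
proof -
  have f: "f \<in> borel_measurable Pr" using measurable_F_Pr[OF _ assms(2)] assms(1) by simp
  have "(\<lambda>\<omega>. step_prob Pr t \<omega> $ i) \<in> borel_measurable Pr"
    using assms by (intro measurable_F_Pr[of t]) auto
  then show ?thesis
    using assms f step_prob_intg[OF equiv_prob_Pr assms]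
    by (simp add: mart_diff_component right_diff_distrib Bochner_Integration.integral_diff integrable_Pr)
qed

text \<open>Distinct coordinates of a basis vector have product zero and each coordinate is
  idempotent, which gives the diagonal term. The two cross terms and the product of the means add up
  to minus the product of the conditional probabilities.\<close>

lemma psi_component:
  assumes "Suc t \<le> T"
  shows "AE \<omega> in Pr. \<forall>i j. psi Pr X t \<omega> $ i $ j =
    (if i = j then step_prob Pr t \<omega> $ i else 0) - step_prob Pr t \<omega> $ i * step_prob Pr t \<omega> $ j"
proof -
  let ?p = "step_prob Pr t"
  have "AE \<omega> in Pr. psi Pr X t \<omega> $ i $ j = (if i = j then ?p \<omega> $ i else 0) - ?p \<omega> $ i * ?p \<omega> $ j" for i j
  proof -
    have "AE \<omega> in Pr. real_cond_exp Pr (F t) (\<lambda>\<omega>. M (Suc t) \<omega> $ i * M (Suc t) \<omega> $ j) \<omega>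
        = (if i = j then ?p \<omega> $ i else 0) - ?p \<omega> $ i * ?p \<omega> $ j"
    proof (rule cond_exp_characterization[OF equiv_prob_Pr])
      show "(\<lambda>\<omega>. M (Suc t) \<omega> $ i * M (Suc t) \<omega> $ j) \<in> borel_measurable Pr"
        using assms by (intro measurable_F_Pr[OF assms] borel_measurable_times mart_diff_measurable)
      fix h :: "'a \<Rightarrow> real" assume h: "h \<in> borel_measurable (F t)"
      have hPr [measurable]: "h \<in> borel_measurable Pr" "(\<lambda>\<omega>. ?p \<omega> $ k) \<in> borel_measurable Pr"
          "(\<lambda>\<omega>. X (Suc t) \<omega> $ k) \<in> borel_measurable Pr" for k
        using h assms by (auto intro: measurable_F_Pr[of t])
      have XX: "X (Suc t) \<omega> $ i * X (Suc t) \<omega> $ j = (if i = j then X (Suc t) \<omega> $ i else 0)"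
        if "\<omega> \<in> space Pr" for \<omega>
        using X_decompose[OF assms that] by (metis mult_cancel_left1 mult_cancel_right1 mult_eq_0_iff)
      have 1: "(\<integral>\<omega>. h \<omega> * (X (Suc t) \<omega> $ i * X (Suc t) \<omega> $ j) \<partial>Pr)
          = (\<integral>\<omega>. h \<omega> * (if i = j then ?p \<omega> $ i else 0) \<partial>Pr)"
        using step_prob_intg[OF equiv_prob_Pr assms h, of i]
        by (cases "i = j"; subst Bochner_Integration.integral_cong[OF refl arg_cong[OF XX]]) auto
      have 2: "(\<integral>\<omega>. h \<omega> * (?p \<omega> $ i * X (Suc t) \<omega> $ j) \<partial>Pr) = (\<integral>\<omega>. h \<omega> * (?p \<omega> $ i * ?p \<omega> $ j) \<partial>Pr)" for i j
        using step_prob_intg[OF equiv_prob_Pr assms, of "\<lambda>\<omega>. h \<omega> * ?p \<omega> $ i" j] h by (simp add: mult.assoc)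
      have "(\<integral>\<omega>. h \<omega> * (M (Suc t) \<omega> $ i * M (Suc t) \<omega> $ j) \<partial>Pr)
          = (\<integral>\<omega>. h \<omega> * (X (Suc t) \<omega> $ i * X (Suc t) \<omega> $ j) - h \<omega> * (?p \<omega> $ i * X (Suc t) \<omega> $ j)
              - h \<omega> * (?p \<omega> $ j * X (Suc t) \<omega> $ i) + h \<omega> * (?p \<omega> $ i * ?p \<omega> $ j) \<partial>Pr)"
        by (intro Bochner_Integration.integral_cong) (auto simp: mart_diff_component algebra_simps)
      also have "\<dots> = (\<integral>\<omega>. h \<omega> * (X (Suc t) \<omega> $ i * X (Suc t) \<omega> $ j) \<partial>Pr)
          - (\<integral>\<omega>. h \<omega> * (?p \<omega> $ i * X (Suc t) \<omega> $ j) \<partial>Pr)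
          - (\<integral>\<omega>. h \<omega> * (?p \<omega> $ j * X (Suc t) \<omega> $ i) \<partial>Pr) + (\<integral>\<omega>. h \<omega> * (?p \<omega> $ i * ?p \<omega> $ j) \<partial>Pr)"
        by (simp add: integrable_Pr)
      also have "\<dots> = (\<integral>\<omega>. h \<omega> * (if i = j then ?p \<omega> $ i else 0) \<partial>Pr)
          - (\<integral>\<omega>. h \<omega> * (?p \<omega> $ i * ?p \<omega> $ j) \<partial>Pr)"
        unfolding 1 2 by (simp add: mult.commute)
      also have "\<dots> = (\<integral>\<omega>. h \<omega> * (if i = j then ?p \<omega> $ i else 0) - h \<omega> * (?p \<omega> $ i * ?p \<omega> $ j) \<partial>Pr)"
        by (rule Bochner_Integration.integral_diff[symmetric]; intro integrable_Pr) auto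
      finally show "(\<integral>\<omega>. h \<omega> * (M (Suc t) \<omega> $ i * M (Suc t) \<omega> $ j) \<partial>Pr)
          = (\<integral>\<omega>. h \<omega> * ((if i = j then ?p \<omega> $ i else 0) - ?p \<omega> $ i * ?p \<omega> $ j) \<partial>Pr)"
        by (simp add: right_diff_distrib)
    qed (use assms in auto)
    then show ?thesis by (simp add: psi_def)
  qed
  then show ?thesis by (simp add: AE_all_countable)
qed

lemma psi_intg:
  assumes "Suc t \<le> T" "f \<in> borel_measurable (F t)"
  shows "(\<integral>\<omega>. f \<omega> * (M (Suc t) \<omega> $ i * M (Suc t) \<omega> $ j) \<partial>Pr) = (\<integral>\<omega>. f \<omega> * psi Pr X t \<omega> $ i $ j \<partial>Pr)"
proof -
  have "(\<lambda>\<omega>. M (Suc t) \<omega> $ i * M (Suc t) \<omega> $ j) \<in> borel_measurable Pr"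
    using assms by (intro measurable_F_Pr[OF assms(1)] borel_measurable_times mart_diff_measurable)
  from cond_exp_intg[OF equiv_prob_Pr _ assms(2) this] show ?thesis
    using assms(1) by (simp add: psi_def)
qed

lemma psi_measurable: "(\<lambda>\<omega>. psi Pr X t \<omega> $ i $ j) \<in> borel_measurable (F t)"
  by (simp add: psi_def)

section \<open>Equivalent measures and their Q-vector processes\<close>

text \<open>Moving the pseudoinverse to the other side of the inner product turns a density factor
  into \<open>1 + w \<bullet> M (Suc t)\<close> with an adapted \<open>w\<close>. The equation
  \<open>psi *v w = \<theta>\<close> is \<open>multinomial_cov_solve\<close>, whose support
  condition holds because the reachable states are those of positive conditional
  probability.\<close>

lemma Q_vector_coefficient:
  assumes \<theta>: "Q_vector_process Pr X T \<theta>" and t: "t < T"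
  obtains w where "w \<in> borel_measurable (F t)"
    "AE \<omega> in Pr. (\<forall>x. \<theta> t \<omega> \<bullet> (pinv (psi Pr X t \<omega>) *v x) = w \<omega> \<bullet> x) \<and> psi Pr X t \<omega> *v w \<omega> = \<theta> t \<omega>"
proof -
  from \<theta> t have \<theta>m: "\<theta> t \<in> borel_measurable (F t)"
    and \<theta>0: "AE \<omega> in Pr. (\<Sum>j\<in>UNIV. \<theta> t \<omega> $ j) = 0 \<and> (\<forall>i. i \<notin> reachable Pr X t \<omega> \<longrightarrow> \<theta> t \<omega> $ i = 0)"
    unfolding Q_vector_process_def by auto
  obtain H where H: "AE \<omega> in Pr. \<theta> t \<omega> = H (history t \<omega>)"
    using AE_function_of_history_vec[OF less_imp_le[OF t] \<theta>m] .
  have "(\<lambda>\<omega>. psi Pr X t \<omega> $ i) \<in> borel_measurable (F t)" for i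
    by (intro borel_measurable_vecI psi_measurable)
  then have "\<exists>G. AE \<omega> in Pr. psi Pr X t \<omega> $ i = G (history t \<omega>)" for i
    using AE_function_of_history_vec[OF less_imp_le[OF t]] by metis
  then obtain G where "\<And>i. AE \<omega> in Pr. psi Pr X t \<omega> $ i = G i (history t \<omega>)" by metis
  then have G: "AE \<omega> in Pr. \<forall>i. psi Pr X t \<omega> $ i = G i (history t \<omega>)"
    by (simp add: AE_all_countable)
  \<comment> \<open>Versions of \<open>psi\<close> and \<theta> as functions of the history are
    inserted, so that \<open>w\<close> is adapted although it contains \<open>pinv\<close>.\<close>
  define w where "w \<omega> = transpose (pinv (\<chi> i. G i (history t \<omega>))) *v H (history t \<omega>)" for \<omega>
  have "w \<in> borel_measurable (F t)"
    unfolding w_def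
    using measurable_of_history_F[of t "\<lambda>p. transpose (pinv (\<chi> i. G i p)) *v H p" borel] t by simp
  moreover have "AE \<omega> in Pr. (\<forall>x. \<theta> t \<omega> \<bullet> (pinv (psi Pr X t \<omega>) *v x) = w \<omega> \<bullet> x) \<and>
      psi Pr X t \<omega> *v w \<omega> = \<theta> t \<omega>"
    using G H \<theta>0 step_prob_simplex[OF equiv_prob_Pr Suc_leI[OF t]] psi_component[OF Suc_leI[OF t]]
      reachable_iff[OF Suc_leI[OF t]]
  proof eventually_elim
    case (elim \<omega>)
    have "psi Pr X t \<omega> = (\<chi> i. G i (history t \<omega>))" using elim(1) by (simp add: vec_eq_iff)
    then have w: "w \<omega> = transpose (pinv (psi Pr X t \<omega>)) *v \<theta> t \<omega>"
      using elim(2) by (simp add: w_def)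
    have "psi Pr X t \<omega> *v w \<omega> = \<theta> t \<omega>"
      unfolding w by (rule multinomial_cov_solve[of "step_prob Pr t \<omega>"]) (use elim in auto)
    then show ?case by (simp add: w dot_lmul_matrix transpose_matrix_vector)
  qed
  ultimately show thesis by (rule that)
qed

section \<open>Discrete stochastic exponentials as density processes\<close>

definition stoch_exp :: "(nat \<Rightarrow> 'a \<Rightarrow> real ^ 'm) \<Rightarrow> nat \<Rightarrow> 'a \<Rightarrow> real" where
  "stoch_exp w t \<omega> = (\<Prod>s<t. 1 + w s \<omega> \<bullet> M (Suc s) \<omega>)"

lemma mart_diff_vec_measurable: "Suc t \<le> T \<Longrightarrow> M (Suc t) \<in> borel_measurable (F (Suc t))"
  by (intro borel_measurable_vecI mart_diff_measurable)

lemma stoch_exp_measurable: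
  assumes "\<And>s. s < T \<Longrightarrow> w s \<in> borel_measurable (F s)" "t \<le> T"
  shows "stoch_exp w t \<in> borel_measurable (F t)"
  unfolding stoch_exp_def
proof (intro borel_measurable_prod borel_measurable_add borel_measurable_const borel_measurable_inner)
  fix s assume "s \<in> {..<t}"
  then have s: "s < T" "s \<le> t" "Suc s \<le> t" "Suc s \<le> T" using assms(2) by auto
  show "w s \<in> borel_measurable (F t)"
    by (rule measurable_F_mono[OF s(2) assms(2) assms(1)[OF s(1)]])
  show "M (Suc s) \<in> borel_measurable (F t)"
    by (rule measurable_F_mono[OF s(3) assms(2) mart_diff_vec_measurable[OF s(4)]])
qed

text \<open>This is the martingale property of the stochastic exponential in integrated form: each
  further factor adds an adapted combination of the coordinates of the next martingale difference,
  which has integral zero.\<close>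

lemma stoch_exp_tower:
  assumes w: "\<And>s. s < T \<Longrightarrow> w s \<in> borel_measurable (F s)"
    and "t \<le> u" "u \<le> T" "f \<in> borel_measurable (F t)"
  shows "(\<integral>\<omega>. f \<omega> * stoch_exp w u \<omega> \<partial>Pr) = (\<integral>\<omega>. f \<omega> * stoch_exp w t \<omega> \<partial>Pr)"
  using \<open>t \<le> u\<close> \<open>u \<le> T\<close>
proof (induction u rule: dec_induct)
  case base
  show ?case ..
next
  case (step n)
  then have n: "Suc n \<le> T" "n < T" by auto
  have f: "f \<in> borel_measurable (F n)"
    using measurable_F_mono[OF \<open>t \<le> n\<close> _ assms(4)] n by simp
  have d: "stoch_exp w n \<in> borel_measurable (F n)" using stoch_exp_measurable[OF w] n by simp
  have wn: "(\<lambda>\<omega>. w n \<omega> $ i) \<in> borel_measurable (F n)" for i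
    using w[OF n(2)] by (rule borel_measurable_component)
  note Pr = measurable_F_Pr[OF less_imp_le[OF n(2)]]
  have [measurable]: "(\<lambda>\<omega>. M (Suc n) \<omega> $ i) \<in> borel_measurable Pr" for i
    using mart_diff_measurable[OF n(1)] measurable_F_Pr[OF n(1)] by blast
  note [measurable] = Pr[OF f] Pr[OF d] Pr[OF wn]
  have "f \<omega> * stoch_exp w (Suc n) \<omega>
      = f \<omega> * stoch_exp w n \<omega> + (\<Sum>i\<in>UNIV. f \<omega> * stoch_exp w n \<omega> * w n \<omega> $ i * M (Suc n) \<omega> $ i)" for \<omega>
    by (simp add: stoch_exp_def inner_vec_def distrib_left sum_distrib_left mult.assoc)
  then have "(\<integral>\<omega>. f \<omega> * stoch_exp w (Suc n) \<omega> \<partial>Pr) = (\<integral>\<omega>. f \<omega> * stoch_exp w n \<omega> \<partial>Pr)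
      + (\<Sum>i\<in>UNIV. \<integral>\<omega>. f \<omega> * stoch_exp w n \<omega> * w n \<omega> $ i * M (Suc n) \<omega> $ i \<partial>Pr)"
    by (simp add: integrable_Pr)
  also have "\<dots> = (\<integral>\<omega>. f \<omega> * stoch_exp w n \<omega> \<partial>Pr)"
    using mart_diff_intg_zero[OF n(1), of "\<lambda>\<omega>. f \<omega> * stoch_exp w n \<omega> * w n \<omega> $ _"] f d wn by simp
  finally show ?case using step n by simp
qed

text \<open>This is Girsanov's formula. Under \<open>Pr\<close> the last density factor
  \<open>1 + w \<bullet> M\<close> contributes a linear term in \<open>M\<close> that integrates to
  zero and a quadratic one whose conditional mean is \<open>psi\<close>; then
  \<open>psi *v w = \<theta>\<close> identifies the drift.\<close>

lemma cond_exp_theta_density: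
  assumes \<theta>: "Q_vector_process Pr X T \<theta>" and nonneg: "AE \<omega> in Pr. 0 \<le> theta_density Pr X T \<theta> \<omega>"
    and Q: "equiv_prob Q" "Q = density Pr (\<lambda>\<omega>. ennreal (theta_density Pr X T \<theta> \<omega>))"
    and t: "t < T" and Z: "Z \<in> borel_measurable (F t)"
  shows "AE \<omega> in Pr. real_cond_exp Q (F t) (\<lambda>\<omega>. Z \<omega> \<bullet> M (Suc t) \<omega>) \<omega> = Z \<omega> \<bullet> \<theta> t \<omega>"
proof -
  have "\<exists>v. v \<in> borel_measurable (F s) \<and>
    (AE \<omega> in Pr. (\<forall>x. \<theta> s \<omega> \<bullet> (pinv (psi Pr X s \<omega>) *v x) = v \<omega> \<bullet> x) \<and> psi Pr X s \<omega> *v v \<omega> = \<theta> s \<omega>)"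
    if "s < T" for s
    by (rule Q_vector_coefficient[OF \<theta> that]) blast
  then have "\<forall>s\<in>{..<T}. \<exists>v. v \<in> borel_measurable (F s) \<and>
    (AE \<omega> in Pr. (\<forall>x. \<theta> s \<omega> \<bullet> (pinv (psi Pr X s \<omega>) *v x) = v \<omega> \<bullet> x) \<and> psi Pr X s \<omega> *v v \<omega> = \<theta> s \<omega>)"
    by blast
  from bchoice[OF this] obtain w where w: "\<And>s. s < T \<Longrightarrow> w s \<in> borel_measurable (F s)"
    and w_AE: "\<And>s. s < T \<Longrightarrow> AE \<omega> in Pr.
      (\<forall>x. \<theta> s \<omega> \<bullet> (pinv (psi Pr X s \<omega>) *v x) = w s \<omega> \<bullet> x) \<and> psi Pr X s \<omega> *v w s \<omega> = \<theta> s \<omega>"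
    by blast
  have "AE \<omega> in Pr. \<forall>s\<in>{..<T}. \<forall>x. \<theta> s \<omega> \<bullet> (pinv (psi Pr X s \<omega>) *v x) = w s \<omega> \<bullet> x"
    using w_AE by (intro AE_finite_allI) auto
  then have stoch_exp: "AE \<omega> in Pr. theta_density Pr X T \<theta> \<omega> = stoch_exp w T \<omega>"
    by eventually_elim (auto simp: theta_density_def stoch_exp_def)
  have Q_eq: "Q = density Pr (\<lambda>\<omega>. ennreal (stoch_exp w T \<omega>))"
    unfolding Q(2) using stoch_exp by (intro density_AE_cong) auto
  have stoch_exp_nonneg: "AE \<omega> in Pr. 0 \<le> stoch_exp w T \<omega>"
    using stoch_exp nonneg by eventually_elim auto
  have Q_int: "(\<integral>\<omega>. f \<omega> \<partial>Q) = (\<integral>\<omega>. f \<omega> * stoch_exp w T \<omega> \<partial>Pr)" if "f \<in> borel_measurable Pr" for f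
    unfolding Q_eq using that stoch_exp_nonneg measurable_F_Pr[OF order_refl stoch_exp_measurable[OF w order_refl]]
    by (subst integral_density) (auto simp: mult.commute)
  have T: "Suc t \<le> T" "t \<le> T" using t by auto
  have \<theta>m: "\<theta> t \<in> borel_measurable (F t)" using \<theta> t unfolding Q_vector_process_def by blast
  show ?thesis
  proof (rule cond_exp_characterization[OF Q(1) T(2)])
    have Z': "Z \<in> borel_measurable (F (Suc t))" using measurable_F_mono[OF _ T(1) Z] by simp
    then have ZM: "(\<lambda>\<omega>. Z \<omega> \<bullet> M (Suc t) \<omega>) \<in> borel_measurable (F (Suc t))"
      using mart_diff_vec_measurable[OF T(1)] by (rule borel_measurable_inner)
    then show "(\<lambda>\<omega>. Z \<omega> \<bullet> M (Suc t) \<omega>) \<in> borel_measurable Pr"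
      using measurable_F_Pr[OF T(1)] by blast
    show Z\<theta>: "(\<lambda>\<omega>. Z \<omega> \<bullet> \<theta> t \<omega>) \<in> borel_measurable (F t)"
      using Z \<theta>m by (rule borel_measurable_inner)
    fix h :: "'a \<Rightarrow> real" assume h: "h \<in> borel_measurable (F t)"
    then have h': "h \<in> borel_measurable (F (Suc t))" using measurable_F_mono[OF _ T(1) h] by simp
    have d: "stoch_exp w t \<in> borel_measurable (F t)" using stoch_exp_measurable[OF w T(2)] by blast
    have wt: "(\<lambda>\<omega>. w t \<omega> $ i) \<in> borel_measurable (F t)" for i
      using w[OF t] by (rule borel_measurable_component)
    have Zi: "(\<lambda>\<omega>. Z \<omega> $ i) \<in> borel_measurable (F t)" for i
      using Z by (rule borel_measurable_component)
    note Pr = measurable_F_Pr[OF T(2)]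
    have [measurable]: "(\<lambda>\<omega>. M (Suc t) \<omega> $ i) \<in> borel_measurable Pr" for i
      using mart_diff_measurable[OF T(1)] measurable_F_Pr[OF T(1)] by blast
    note [measurable] = Pr[OF h] Pr[OF d] Pr[OF wt] Pr[OF Zi] Pr[OF psi_measurable]
    have hZM: "(\<lambda>\<omega>. h \<omega> * (Z \<omega> \<bullet> M (Suc t) \<omega>)) \<in> borel_measurable (F (Suc t))"
      using h' ZM by (rule borel_measurable_times)
    have hZ\<theta>: "(\<lambda>\<omega>. h \<omega> * (Z \<omega> \<bullet> \<theta> t \<omega>)) \<in> borel_measurable (F t)"
      using h Z\<theta> by (rule borel_measurable_times)
    \<comment> \<open>The last factor is split off and the inner products are written in
      coordinates, to separate the part linear in \<open>M (Suc t)\<close> from the part quadratic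
      in it.\<close>
    have "h \<omega> * (Z \<omega> \<bullet> M (Suc t) \<omega>) * stoch_exp w (Suc t) \<omega>
        = (\<Sum>i\<in>UNIV. h \<omega> * Z \<omega> $ i * stoch_exp w t \<omega> * M (Suc t) \<omega> $ i)
        + (\<Sum>i\<in>UNIV. \<Sum>j\<in>UNIV. h \<omega> * Z \<omega> $ i * stoch_exp w t \<omega> * w t \<omega> $ j * (M (Suc t) \<omega> $ i * M (Suc t) \<omega> $ j))" for \<omega>
    proof -
      have "h \<omega> * (Z \<omega> \<bullet> M (Suc t) \<omega>) * stoch_exp w (Suc t) \<omega>
          = h \<omega> * (Z \<omega> \<bullet> M (Suc t) \<omega>) * stoch_exp w t \<omega>
          + h \<omega> * stoch_exp w t \<omega> * ((Z \<omega> \<bullet> M (Suc t) \<omega>) * (w t \<omega> \<bullet> M (Suc t) \<omega>))"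
        by (simp add: stoch_exp_def algebra_simps)
      also have "\<dots> = (\<Sum>i\<in>UNIV. h \<omega> * Z \<omega> $ i * stoch_exp w t \<omega> * M (Suc t) \<omega> $ i)
        + (\<Sum>i\<in>UNIV. \<Sum>j\<in>UNIV. h \<omega> * Z \<omega> $ i * stoch_exp w t \<omega> * w t \<omega> $ j * (M (Suc t) \<omega> $ i * M (Suc t) \<omega> $ j))"
        unfolding inner_vec_def sum_product
        by (simp add: sum_distrib_left sum_distrib_right ac_simps)
      finally show ?thesis .
    qed
    then have "(\<integral>\<omega>. h \<omega> * (Z \<omega> \<bullet> M (Suc t) \<omega>) * stoch_exp w (Suc t) \<omega> \<partial>Pr)
        = (\<Sum>i\<in>UNIV. \<integral>\<omega>. h \<omega> * Z \<omega> $ i * stoch_exp w t \<omega> * M (Suc t) \<omega> $ i \<partial>Pr)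
        + (\<Sum>i\<in>UNIV. \<Sum>j\<in>UNIV. \<integral>\<omega>. h \<omega> * Z \<omega> $ i * stoch_exp w t \<omega> * w t \<omega> $ j
            * (M (Suc t) \<omega> $ i * M (Suc t) \<omega> $ j) \<partial>Pr)"
      by (simp add: integrable_Pr)
    also have "\<dots> = (\<Sum>i\<in>UNIV. \<Sum>j\<in>UNIV. \<integral>\<omega>. h \<omega> * Z \<omega> $ i * stoch_exp w t \<omega> * w t \<omega> $ j
            * psi Pr X t \<omega> $ i $ j \<partial>Pr)"
      using mart_diff_intg_zero[OF T(1), of "\<lambda>\<omega>. h \<omega> * Z \<omega> $ _ * stoch_exp w t \<omega>"]
        psi_intg[OF T(1), of "\<lambda>\<omega>. h \<omega> * Z \<omega> $ _ * stoch_exp w t \<omega> * w t \<omega> $ _"] h Zi d wt by simp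
    also have "\<dots> = (\<integral>\<omega>. (\<Sum>i\<in>UNIV. \<Sum>j\<in>UNIV. h \<omega> * Z \<omega> $ i * stoch_exp w t \<omega> * w t \<omega> $ j
            * psi Pr X t \<omega> $ i $ j) \<partial>Pr)"
      by (simp add: integrable_Pr)
    also have "\<dots> = (\<integral>\<omega>. h \<omega> * (Z \<omega> \<bullet> \<theta> t \<omega>) * stoch_exp w t \<omega> \<partial>Pr)"
    proof (rule integral_cong_AE)
      show "AE \<omega> in Pr. (\<Sum>i\<in>UNIV. \<Sum>j\<in>UNIV. h \<omega> * Z \<omega> $ i * stoch_exp w t \<omega> * w t \<omega> $ j
            * psi Pr X t \<omega> $ i $ j) = h \<omega> * (Z \<omega> \<bullet> \<theta> t \<omega>) * stoch_exp w t \<omega>"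
        using w_AE[OF t]
      proof eventually_elim
        case (elim \<omega>)
        then have "\<theta> t \<omega> = psi Pr X t \<omega> *v w t \<omega>" by simp
        then show ?case
          by (simp add: inner_vec_def matrix_vector_mult_def sum_distrib_left sum_distrib_right ac_simps)
      qed
      show "(\<lambda>\<omega>. h \<omega> * (Z \<omega> \<bullet> \<theta> t \<omega>) * stoch_exp w t \<omega>) \<in> borel_measurable Pr"
        using Pr[OF hZ\<theta>] Pr[OF d] by (rule borel_measurable_times)
    qed measurable
    finally have *: "(\<integral>\<omega>. h \<omega> * (Z \<omega> \<bullet> M (Suc t) \<omega>) * stoch_exp w (Suc t) \<omega> \<partial>Pr)
        = (\<integral>\<omega>. h \<omega> * (Z \<omega> \<bullet> \<theta> t \<omega>) * stoch_exp w t \<omega> \<partial>Pr)" .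
    \<comment> \<open>The density at the horizon is reduced to time \<open>Suc t\<close> on the left
      and to time \<open>t\<close> on the right, since these are the times at which the integrands
      are known.\<close>
    have "(\<integral>\<omega>. h \<omega> * (Z \<omega> \<bullet> M (Suc t) \<omega>) \<partial>Q)
        = (\<integral>\<omega>. h \<omega> * (Z \<omega> \<bullet> M (Suc t) \<omega>) * stoch_exp w (Suc t) \<omega> \<partial>Pr)"
      using Q_int[OF measurable_F_Pr[OF T(1) hZM]] stoch_exp_tower[OF w T(1) order_refl hZM] by simp
    also have "\<dots> = (\<integral>\<omega>. h \<omega> * (Z \<omega> \<bullet> \<theta> t \<omega>) \<partial>Q)"
      using * Q_int[OF Pr[OF hZ\<theta>]] stoch_exp_tower[OF w T(2) order_refl hZ\<theta>] by simp
    finally show "(\<integral>\<omega>. h \<omega> * (Z \<omega> \<bullet> M (Suc t) \<omega>) \<partial>Q) = (\<integral>\<omega>. h \<omega> * (Z \<omega> \<bullet> \<theta> t \<omega>) \<partial>Q)" .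
  qed
qed

section \<open>Likelihood ratios of equivalent measures\<close>

lemma AE_const_time_0:
  fixes f :: "'a \<Rightarrow> real"
  assumes "f \<in> borel_measurable (F 0)"
  obtains c where "AE \<omega> in Pr. f \<omega> = c"
proof -
  obtain G where G: "AE \<omega> in Pr. f \<omega> = G (history 0 \<omega>)"
    using AE_function_of_history[OF _ assms] by auto
  have level: "{\<omega> \<in> space Pr. history 0 \<omega> = p} \<in> sets (F 0)" for p
    using measurable_sets[OF measurable_nat_filt_F[OF _ measurable_ident], of 0 "{\<omega> \<in> space Pr. history 0 \<omega> = p}"]
      history_level_set[of 0 p] by (auto simp: vimage_def Int_def conj_commute cong: conj_cong)
  have ev: "{\<omega> \<in> space Pr. history 0 \<omega> = p} \<in> sets Pr" for p
    using level subalgebra_F[of 0] by (auto simp: subalgebra_def)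
  \<comment> \<open>The finitely many level sets cover the space and each has probability zero or
    one, so they cannot all be null.\<close>
  have "\<exists>p\<in>histories 0. prob {\<omega> \<in> space Pr. history 0 \<omega> = p} = 1"
  proof (rule ccontr)
    assume "\<not> ?thesis"
    then have "AE \<omega> in Pr. history 0 \<omega> \<noteq> p" if "p \<in> histories 0" for p
      using trivial_start[OF level, of p] that ev[of p] by (auto simp: prob_eq_0)
    then have "AE \<omega> in Pr. \<forall>p\<in>histories 0. history 0 \<omega> \<noteq> p"
      by (intro AE_finite_allI finite_histories)
    then have "AE \<omega> in Pr. False"
      using AE_space by eventually_elim (use history_in_histories[of 0] in auto)
    then show False by simp
  qed
  then obtain p where "prob {\<omega> \<in> space Pr. history 0 \<omega> = p} = 1" by blast
  then have "AE \<omega> in Pr. history 0 \<omega> = p"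
    using prob_eq_1[OF ev] by auto
  with G have "AE \<omega> in Pr. f \<omega> = G p" by eventually_elim auto
  then show thesis by (rule that)
qed

text \<open>The inner sum selects the ratio of the one-step probabilities at the state actually
  reached, so this is the candidate for the density of \<open>Q\<close> on \<open>F t\<close>. Where
  the denominator is zero the quotient is zero by convention, but such a state is almost surely not
  reached.\<close>

definition likelihood :: "'a measure \<Rightarrow> nat \<Rightarrow> 'a \<Rightarrow> real" where
  "likelihood Q t \<omega> = (\<Prod>s<t. \<Sum>i\<in>UNIV. step_prob Q s \<omega> $ i / step_prob Pr s \<omega> $ i * X (Suc s) \<omega> $ i)"

lemma likelihood_measurable:
  assumes "t \<le> T"
  shows "likelihood Q t \<in> borel_measurable (F t)"
  unfolding likelihood_def
proof (intro borel_measurable_prod borel_measurable_sum borel_measurable_times borel_measurable_divide)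
  fix s i assume "s \<in> {..<t}"
  then show "(\<lambda>\<omega>. X (Suc s) \<omega> $ i) \<in> borel_measurable (F t)"
    "(\<lambda>\<omega>. step_prob Q s \<omega> $ i) \<in> borel_measurable (F t)"
    "(\<lambda>\<omega>. step_prob Pr s \<omega> $ i) \<in> borel_measurable (F t)"
    using X_component[of "Suc s" t] measurable_F_mono[OF _ assms step_prob_measurable, of s] assms by auto
qed

text \<open>At time zero \<open>f\<close> is almost surely constant, so both measures give the same
  integral. In the induction step \<open>f\<close> is split along the next state, whose coordinates
  may be exchanged with the one-step probabilities of whichever measure integrates them. The
  induction hypothesis is applied to the resulting integrands, hence the arbitrary
  \<open>f\<close>.\<close>

lemma integral_likelihood:
  fixes f :: "'a \<Rightarrow> real"
  assumes Q: "equiv_prob Q" and "t \<le> T" "f \<in> borel_measurable (F t)"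
  shows "(\<integral>\<omega>. f \<omega> \<partial>Q) = (\<integral>\<omega>. f \<omega> * likelihood Q t \<omega> \<partial>Pr)"
  using assms(2,3)
proof (induction t arbitrary: f)
  case 0
  interpret Q: prob_space Q using Q unfolding equiv_prob_def by blast
  obtain c where c: "AE \<omega> in Pr. f \<omega> = c" using AE_const_time_0[OF 0(2)] .
  have f: "f \<in> borel_measurable Pr" using measurable_F_Pr[OF 0] .
  have "(\<integral>\<omega>. f \<omega> \<partial>Q) = (\<integral>\<omega>. c \<partial>Q)"
    using f c by (intro integral_cong_AE) (auto simp: equiv_prob_AE[OF Q] equiv_prob_measurable[OF Q])
  moreover have "(\<integral>\<omega>. f \<omega> \<partial>Pr) = (\<integral>\<omega>. c \<partial>Pr)"
    using f c by (intro integral_cong_AE) auto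
  ultimately show ?case by (simp add: likelihood_def prob_space Q.prob_space)
next
  case (Suc t)
  then have T: "Suc t \<le> T" "t \<le> T" by auto
  let ?p = "step_prob Pr t" and ?q = "step_prob Q t"
  obtain h where h: "\<And>i. h i \<in> borel_measurable (F t)"
    "AE \<omega> in Pr. f \<omega> = (\<Sum>i\<in>UNIV. h i \<omega> * X (Suc t) \<omega> $ i)"
    using decompose_next_step[OF Suc.prems] by blast
  note Pr = measurable_F_Pr[OF T(2)]
  note d = likelihood_measurable[OF T(2), of Q]
  note [measurable] = Pr[OF h(1)] Pr[OF d] Pr[OF step_prob_measurable] X_component_Pr[OF T(1)]
    measurable_F_Pr[OF Suc.prems] measurable_F_Pr[OF T(1) likelihood_measurable[OF T(1)]]
  have "(\<integral>\<omega>. f \<omega> \<partial>Q) = (\<integral>\<omega>. (\<Sum>i\<in>UNIV. h i \<omega> * X (Suc t) \<omega> $ i) \<partial>Q)"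
    using h(2) by (intro integral_cong_AE) (auto simp: equiv_prob_AE[OF Q] equiv_prob_measurable[OF Q])
  also have "\<dots> = (\<Sum>i\<in>UNIV. \<integral>\<omega>. h i \<omega> * ?q \<omega> $ i \<partial>Q)"
    using step_prob_intg[OF Q T(1) h(1)] by (simp add: equiv_prob_integrable[OF Q])
  also have "\<dots> = (\<Sum>i\<in>UNIV. \<integral>\<omega>. h i \<omega> * ?q \<omega> $ i * likelihood Q t \<omega> \<partial>Pr)"
    using h(1) by (intro sum.cong refl Suc.IH T(2) borel_measurable_times step_prob_measurable) auto
  \<comment> \<open>Expanding by \<open>?p\<close> is harmless where it vanishes, because
    \<open>?q\<close> vanishes there as well. Afterwards \<open>?p\<close> is turned back into the
    next state under \<open>Pr\<close>.\<close>
  also have "\<dots> = (\<Sum>i\<in>UNIV. \<integral>\<omega>. h i \<omega> * likelihood Q t \<omega> * (?q \<omega> $ i / ?p \<omega> $ i) * ?p \<omega> $ i \<partial>Pr)"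
  proof (intro sum.cong refl integral_cong_AE)
    fix i
    show "AE \<omega> in Pr. h i \<omega> * ?q \<omega> $ i * likelihood Q t \<omega>
        = h i \<omega> * likelihood Q t \<omega> * (?q \<omega> $ i / ?p \<omega> $ i) * ?p \<omega> $ i"
      using step_prob_zero_off_support[OF Q T(1)] by eventually_elim auto
  qed measurable
  also have "\<dots> = (\<Sum>i\<in>UNIV. \<integral>\<omega>. h i \<omega> * likelihood Q t \<omega> * (?q \<omega> $ i / ?p \<omega> $ i) * X (Suc t) \<omega> $ i \<partial>Pr)"
    using h(1) d by (intro sum.cong refl step_prob_intg[OF equiv_prob_Pr T(1), symmetric]
        borel_measurable_times borel_measurable_divide step_prob_measurable) auto
  also have "\<dots> = (\<integral>\<omega>. (\<Sum>i\<in>UNIV. h i \<omega> * likelihood Q t \<omega> * (?q \<omega> $ i / ?p \<omega> $ i) * X (Suc t) \<omega> $ i) \<partial>Pr)"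
    by (simp add: integrable_Pr)
  also have "\<dots> = (\<integral>\<omega>. f \<omega> * likelihood Q (Suc t) \<omega> \<partial>Pr)"
  proof (rule integral_cong_AE)
    show "AE \<omega> in Pr. (\<Sum>i\<in>UNIV. h i \<omega> * likelihood Q t \<omega> * (?q \<omega> $ i / ?p \<omega> $ i) * X (Suc t) \<omega> $ i)
        = f \<omega> * likelihood Q (Suc t) \<omega>"
      using h(2) AE_space
    proof eventually_elim
      case (elim \<omega>)
      obtain k where "\<forall>j. X (Suc t) \<omega> $ j = (if j = k then 1 else 0)"
        using X_decompose[OF T(1) elim(2)] by metis
      then have "f \<omega> = h k \<omega>" "X (Suc t) \<omega> = (\<chi> j. if j = k then 1 else 0)"
        by (simp_all add: elim(1) mult_delta_right vec_eq_iff)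
      then show ?case
        by (simp add: likelihood_def mult_delta_right mult.assoc del: times_divide_eq_left times_divide_eq_right)
    qed
  qed measurable
  finally show ?case .
qed

text \<open>Every equivalent measure is represented by the difference of the one-step laws, because
  the resulting product of factors is the likelihood ratio.\<close>

lemma theta_density_step_prob:
  assumes Q: "equiv_prob Q"
  defines "\<theta> \<equiv> \<lambda>t \<omega>. step_prob Q t \<omega> - step_prob Pr t \<omega>"
  shows "Q_vector_process Pr X T \<theta>" "AE \<omega> in Pr. 0 \<le> theta_density Pr X T \<theta> \<omega>"
    "density Pr (\<lambda>\<omega>. ennreal (theta_density Pr X T \<theta> \<omega>)) = Q"
proof -
  show \<theta>: "Q_vector_process Pr X T \<theta>"
    unfolding Q_vector_process_def
  proof (intro allI impI conjI)
    fix t assume "t < T"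
    then have T: "Suc t \<le> T" "t \<le> T" by auto
    show \<theta>m: "\<theta> t \<in> borel_measurable (F t)"
      unfolding \<theta>_def by (rule borel_measurable_vecI) simp
    \<comment> \<open>Probability vectors have components at most one, so their norm is at most that
      of the all-ones vector; this bound gives integrability.\<close>
    have "AE \<omega> in Pr. norm (\<theta> t \<omega>) \<le> norm (1 :: real ^ 'm) + norm (1 :: real ^ 'm)"
      using step_prob_simplex[OF Q T(1)] step_prob_simplex[OF equiv_prob_Pr T(1)]
    proof eventually_elim
      case (elim \<omega>)
      have "v $ i \<le> 1" if "\<forall>i. 0 \<le> v $ i" "(\<Sum>i\<in>UNIV. v $ i) = 1" for v :: "real ^ 'm" and i
        using member_le_sum[of i UNIV "\<lambda>i. v $ i"] that by auto
      then have "norm (v :: real ^ 'm) \<le> norm (1 :: real ^ 'm)"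
        if "\<forall>i. 0 \<le> v $ i" "(\<Sum>i\<in>UNIV. v $ i) = 1" for v
        using that by (intro norm_le_componentwise_cart) auto
      then show ?case
        unfolding \<theta>_def using elim norm_triangle_ineq4 by (smt (verit, best))
    qed
    then show "integrable Pr (\<theta> t)"
      by (rule integrable_const_bound) (rule measurable_F_Pr[OF T(2) \<theta>m])
    show "AE \<omega> in Pr. (\<Sum>j\<in>UNIV. \<theta> t \<omega> $ j) = 0 \<and> (\<forall>i. i \<notin> reachable Pr X t \<omega> \<longrightarrow> \<theta> t \<omega> $ i = 0)"
      using step_prob_simplex[OF Q T(1)] step_prob_simplex[OF equiv_prob_Pr T(1)]
        reachable_iff[OF T(1)] step_prob_zero_off_support[OF Q T(1)]
    proof eventually_elim
      case (elim \<omega>)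
      then show ?case
        by (auto simp: \<theta>_def sum_subtractf) (metis less_eq_real_def)
    qed
  qed
  have "AE \<omega> in Pr. 1 + \<theta> t \<omega> \<bullet> (pinv (psi Pr X t \<omega>) *v M (Suc t) \<omega>)
      = (\<Sum>i\<in>UNIV. step_prob Q t \<omega> $ i / step_prob Pr t \<omega> $ i * X (Suc t) \<omega> $ i)" if "t < T" for t
  proof -
    have T: "Suc t \<le> T" using that by simp
    obtain w where "AE \<omega> in Pr. (\<forall>x. \<theta> t \<omega> \<bullet> (pinv (psi Pr X t \<omega>) *v x) = w \<omega> \<bullet> x) \<and>
        psi Pr X t \<omega> *v w \<omega> = \<theta> t \<omega>"
      by (rule Q_vector_coefficient[OF \<theta> \<open>t < T\<close>])
    then show ?thesis
      using psi_component[OF T] X_zero_off_support[OF T] AE_space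
    proof eventually_elim
      case (elim \<omega>)
      let ?p = "step_prob Pr t \<omega>" and ?q = "step_prob Q t \<omega>"
      obtain k where k: "\<forall>j. X (Suc t) \<omega> $ j = (if j = k then 1 else 0)"
        using X_decompose[OF T elim(4)] by metis
      then have pk: "?p $ k \<noteq> 0" using elim(3) by (metis zero_neq_one)
      \<comment> \<open>Here \<open>k\<close> is the state reached. Coordinate \<open>k\<close> of
        \<open>psi *v w = \<theta>\<close> is read off from the covariance formula, and
        \<open>M (Suc t)\<close> is the basis vector of \<open>k\<close> minus
        \<open>?p\<close>.\<close>
      have "?q $ k - ?p $ k = (psi Pr X t \<omega> *v w \<omega>) $ k"
        using elim(1) by (simp add: \<theta>_def)
      also have "\<dots> = ?p $ k * (w \<omega> $ k - (\<Sum>j\<in>UNIV. ?p $ j * w \<omega> $ j))"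
        using elim(2) by (simp add: matrix_vector_mult_def left_diff_distrib right_diff_distrib
            sum_subtractf mult_delta_left sum_distrib_left mult.assoc)
      also have "w \<omega> $ k - (\<Sum>j\<in>UNIV. ?p $ j * w \<omega> $ j) = w \<omega> \<bullet> M (Suc t) \<omega>"
        using k by (simp add: inner_vec_def mart_diff_component right_diff_distrib sum_subtractf
            mult_delta_right mult.commute)
      finally have "1 + w \<omega> \<bullet> M (Suc t) \<omega> = ?q $ k / ?p $ k"
        using pk by (simp add: field_simps)
      then show ?case using elim(1) k by (simp add: mult_delta_right)
    qed
  qed
  then have "AE \<omega> in Pr. \<forall>t\<in>{..<T}. 1 + \<theta> t \<omega> \<bullet> (pinv (psi Pr X t \<omega>) *v M (Suc t) \<omega>)
      = (\<Sum>i\<in>UNIV. step_prob Q t \<omega> $ i / step_prob Pr t \<omega> $ i * X (Suc t) \<omega> $ i)"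
    by (intro AE_finite_allI) auto
  then have eq: "AE \<omega> in Pr. theta_density Pr X T \<theta> \<omega> = likelihood Q T \<omega>"
    by eventually_elim (simp add: theta_density_def likelihood_def)
  have "AE \<omega> in Pr. \<forall>t\<in>{..<T}. \<forall>i. 0 \<le> step_prob Q t \<omega> $ i / step_prob Pr t \<omega> $ i"
  proof (intro AE_finite_allI)
    fix t assume "t \<in> {..<T}"
    then have T: "Suc t \<le> T" by simp
    show "AE \<omega> in Pr. \<forall>i. 0 \<le> step_prob Q t \<omega> $ i / step_prob Pr t \<omega> $ i"
      using step_prob_simplex[OF Q T] step_prob_simplex[OF equiv_prob_Pr T]
      by eventually_elim auto
  qed simp
  then have pos: "AE \<omega> in Pr. 0 \<le> likelihood Q T \<omega>"
    using AE_space
  proof eventually_elim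
    case (elim \<omega>)
    show ?case
      unfolding likelihood_def
    proof (intro prod_nonneg sum_nonneg mult_nonneg_nonneg)
      fix t i assume "t \<in> {..<T}"
      then show "0 \<le> step_prob Q t \<omega> $ i / step_prob Pr t \<omega> $ i" using elim(1) by blast
      have "Suc t \<le> T" using \<open>t \<in> {..<T}\<close> by simp
      then show "0 \<le> X (Suc t) \<omega> $ i" using X_decompose[OF _ elim(2)] by (metis order_refl zero_le_one)
    qed
  qed
  show "AE \<omega> in Pr. 0 \<le> theta_density Pr X T \<theta> \<omega>"
    using eq pos by eventually_elim auto
  have l [measurable]: "likelihood Q T \<in> borel_measurable Pr"
    using likelihood_measurable[OF order_refl] measurable_Pr_F_T by blast
  have "density Pr (\<lambda>\<omega>. ennreal (theta_density Pr X T \<theta> \<omega>)) = density Pr (\<lambda>\<omega>. ennreal (likelihood Q T \<omega>))"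
    using eq by (intro density_AE_cong) auto
  \<comment> \<open>The measures agree on every event, by \<open>integral_likelihood\<close> for its
    indicator at the horizon, where \<open>F T\<close> has the measurable sets of
    \<open>Pr\<close>.\<close>
  also have "\<dots> = Q"
  proof (rule measure_eqI)
    show sQ: "sets (density Pr (\<lambda>\<omega>. ennreal (likelihood Q T \<omega>))) = sets Q"
      using Q by (simp add: equiv_prob_def)
    interpret Q: prob_space Q using Q unfolding equiv_prob_def by blast
    fix A assume "A \<in> sets (density Pr (\<lambda>\<omega>. ennreal (likelihood Q T \<omega>)))"
    then have A [measurable]: "A \<in> sets Pr" and AQ: "A \<in> sets Q" using sQ by auto
    have "emeasure (density Pr (\<lambda>\<omega>. ennreal (likelihood Q T \<omega>))) A
        = (\<integral>\<^sup>+ \<omega>. ennreal (indicator A \<omega> * likelihood Q T \<omega>) \<partial>Pr)"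
      by (subst emeasure_density) (auto intro!: nn_integral_cong simp: indicator_def)
    also have "\<dots> = ennreal (\<integral>\<omega>. indicator A \<omega> * likelihood Q T \<omega> \<partial>Pr)"
      using pos by (intro nn_integral_eq_integral integrable_Pr) auto
    also have "(\<integral>\<omega>. indicator A \<omega> * likelihood Q T \<omega> \<partial>Pr) = (\<integral>\<omega>. indicator A \<omega> \<partial>Q)"
      using integral_likelihood[OF Q order_refl, of "indicator A"] A sets_Pr by simp
    also have "ennreal \<dots> = emeasure Q A"
      using AQ by (simp add: Q.emeasure_eq_measure)
    finally show "emeasure (density Pr (\<lambda>\<omega>. ennreal (likelihood Q T \<omega>))) A = emeasure Q A" .
  qed
  finally show "density Pr (\<lambda>\<omega>. ennreal (theta_density Pr X T \<theta> \<omega>)) = Q" .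
qed

section \<open>The Snell recursion\<close>

lemma ess_inf_cond_exp_exists:
  assumes "\<Lambda> \<noteq> {}" "t \<le> T"
  obtains e where "e \<in> borel_measurable (F t)"
    "is_ess_inf Pr \<Lambda> (\<lambda>Q. real_cond_exp Q (F t) f) e"
  using ess_inf_exists[OF assms(2,1), of "\<lambda>Q. real_cond_exp Q (F t) f"] by auto

text \<open>The bridge between the two infima: up to null sets, the drifts indexed by
  \<open>Theta_set\<close> and the conditional expectations indexed by \<Lambda> are the same random
  variables. One direction is Girsanov's formula, the other also needs the representation of each
  prior by a Q-vector process.\<close>

lemma Theta_set_cond_exp:
  assumes \<Lambda>: "\<And>Q. Q \<in> \<Lambda> \<Longrightarrow> equiv_prob Q" and t: "t < T" and Z: "Z \<in> borel_measurable (F t)"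
  shows "\<theta> \<in> Theta_set Pr X T \<Lambda> \<Longrightarrow>
      \<exists>Q\<in>\<Lambda>. AE \<omega> in Pr. real_cond_exp Q (F t) (\<lambda>\<omega>. Z \<omega> \<bullet> M (Suc t) \<omega>) \<omega> = Z \<omega> \<bullet> \<theta> t \<omega>"
    and "Q \<in> \<Lambda> \<Longrightarrow>
      \<exists>\<theta>\<in>Theta_set Pr X T \<Lambda>. AE \<omega> in Pr. real_cond_exp Q (F t) (\<lambda>\<omega>. Z \<omega> \<bullet> M (Suc t) \<omega>) \<omega> = Z \<omega> \<bullet> \<theta> t \<omega>"
proof -
  show "\<exists>Q\<in>\<Lambda>. AE \<omega> in Pr. real_cond_exp Q (F t) (\<lambda>\<omega>. Z \<omega> \<bullet> M (Suc t) \<omega>) \<omega> = Z \<omega> \<bullet> \<theta> t \<omega>"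
    if "\<theta> \<in> Theta_set Pr X T \<Lambda>"
    using that cond_exp_theta_density[OF _ _ \<Lambda> refl t Z, of \<theta>] unfolding Theta_set_def by blast
  assume Q: "Q \<in> \<Lambda>"
  define \<theta> where "\<theta> = (\<lambda>t \<omega>. step_prob Q t \<omega> - step_prob Pr t \<omega>)"
  note \<theta> = theta_density_step_prob[OF \<Lambda>[OF Q], folded \<theta>_def]
  have "\<theta> \<in> Theta_set Pr X T \<Lambda>" using \<theta> Q by (simp add: Theta_set_def)
  then show "\<exists>\<theta>\<in>Theta_set Pr X T \<Lambda>. AE \<omega> in Pr.
      real_cond_exp Q (F t) (\<lambda>\<omega>. Z \<omega> \<bullet> M (Suc t) \<omega>) \<omega> = Z \<omega> \<bullet> \<theta> t \<omega>"
    using cond_exp_theta_density[OF \<theta>(1,2) \<Lambda>[OF Q] \<theta>(3)[symmetric] t Z] by blast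
qed

text \<open>One backward step, with \<open>y'\<close> for the next value and \<open>k\<close> for
  the increment of the reflecting process. Non-negativity of \<open>k\<close> gives
  \<open>e \<le> y\<close>; the complementarity condition gives equality where
  \<open>u < y\<close>.\<close>

lemma reflected_step:
  fixes y u y' k :: "'a \<Rightarrow> real"
  assumes \<Lambda>: "\<Lambda> \<noteq> {}" "\<And>Q. Q \<in> \<Lambda> \<Longrightarrow> equiv_prob Q" and t: "t < T"
    and y: "y \<in> borel_measurable (F t)" and u: "u \<in> borel_measurable (F t)"
    and Z: "Z \<in> borel_measurable (F t)"
    and y': "y' \<in> borel_measurable Pr" and k: "k \<in> borel_measurable Pr" and k_nonneg: "AE \<omega> in Pr. 0 \<le> k \<omega>"
    and g: "is_ess_inf Pr (Theta_set Pr X T \<Lambda>) (\<lambda>\<theta> \<omega>. Z \<omega> \<bullet> \<theta> t \<omega>) g"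
    and eq: "AE \<omega> in Pr. ereal (y \<omega>) = ereal (y' \<omega>) + g \<omega> - ereal (Z \<omega> \<bullet> M (Suc t) \<omega>) + ereal (k \<omega>)"
    and y_ge: "AE \<omega> in Pr. u \<omega> \<le> y \<omega>" and sk: "AE \<omega> in Pr. (y \<omega> - u \<omega>) * k \<omega> = 0"
    and e: "e \<in> borel_measurable (F t)" "is_ess_inf Pr \<Lambda> (\<lambda>Q. real_cond_exp Q (F t) y') e"
  shows "AE \<omega> in Pr. ereal (y \<omega>) = max (ereal (u \<omega>)) (e \<omega>)"
proof -
  let ?\<Theta> = "Theta_set Pr X T \<Lambda>"
  have T: "t \<le> T" "Suc t \<le> T" using t by auto
  have "?\<Theta> \<noteq> {}" using Theta_set_cond_exp(2)[OF \<Lambda>(2) t Z] \<Lambda>(1) by blast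
  moreover have "(\<lambda>\<omega>. Z \<omega> \<bullet> \<theta> t \<omega>) \<in> borel_measurable (F t)" if "\<theta> \<in> ?\<Theta>" for \<theta>
    using that t by (intro borel_measurable_inner[OF Z]) (auto simp: Theta_set_def Q_vector_process_def)
  \<comment> \<open>The given infimum \<open>g\<close> is only \<open>Pr\<close>-measurable. An
    adapted version is required to take it out of conditional expectations.\<close>
  ultimately obtain g' where g': "g' \<in> borel_measurable (F t)" "is_ess_inf Pr ?\<Theta> (\<lambda>\<theta> \<omega>. Z \<omega> \<bullet> \<theta> t \<omega>) g'"
    using ess_inf_exists[OF T(1), of ?\<Theta> "\<lambda>\<theta> \<omega>. Z \<omega> \<bullet> \<theta> t \<omega>"] by auto
  have gg': "AE \<omega> in Pr. g \<omega> = g' \<omega>"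
    by (rule is_ess_inf_AE_unique[OF g g'(2)]) auto
  define \<gamma> where "\<gamma> \<omega> = real_of_ereal (g' \<omega>)" for \<omega>
  have \<gamma>: "\<gamma> \<in> borel_measurable (F t)" unfolding \<gamma>_def using g'(1) by simp
  \<comment> \<open>The left side of the extended real equation is finite, which forces
    \<open>g\<close> to be finite; only then can the equation be solved for
    \<open>y'\<close>.\<close>
  have y'_eq: "AE \<omega> in Pr. g \<omega> = ereal (\<gamma> \<omega>) \<and> y' \<omega> = (y \<omega> - \<gamma> \<omega>) + Z \<omega> \<bullet> M (Suc t) \<omega> - k \<omega>"
    using eq gg'
  proof eventually_elim
    case (elim \<omega>)
    then show ?case by (cases "g' \<omega>") (auto simp: \<gamma>_def)
  qed
  have ZM: "(\<lambda>\<omega>. Z \<omega> \<bullet> M (Suc t) \<omega>) \<in> borel_measurable Pr"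
    by (intro borel_measurable_inner measurable_F_Pr[OF T(1) Z]
        measurable_F_Pr[OF T(2) mart_diff_vec_measurable[OF T(2)]])
  have yg: "(\<lambda>\<omega>. y \<omega> - \<gamma> \<omega>) \<in> borel_measurable (F t)" using y \<gamma> by simp
  note Pr = measurable_F_Pr[OF T(1)]
  have decomp: "AE \<omega> in Pr. real_cond_exp Q (F t) y' \<omega>
      = y \<omega> - \<gamma> \<omega> + real_cond_exp Q (F t) (\<lambda>\<omega>. Z \<omega> \<bullet> M (Suc t) \<omega>) \<omega> - real_cond_exp Q (F t) k \<omega>"
    and k_pos: "AE \<omega> in Pr. 0 \<le> real_cond_exp Q (F t) k \<omega>"
    and k_zero: "AE \<omega> in Pr. (y \<omega> - u \<omega>) * real_cond_exp Q (F t) k \<omega> = 0" if Q\<Lambda>: "Q \<in> \<Lambda>" for Q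
  proof -
    have Q: "equiv_prob Q" using \<Lambda>(2) Q\<Lambda> .
    interpret Q: finite_measure_subalgebra Q "F t" by (rule equiv_prob_subalgebra[OF Q T(1)])
    note int = equiv_prob_integrable[OF Q]
    note [measurable] = Pr[OF y] Pr[OF u] Pr[OF \<gamma>] ZM y' k
    have "AE \<omega> in Q. real_cond_exp Q (F t) y' \<omega>
        = real_cond_exp Q (F t) (\<lambda>\<omega>. (y \<omega> - \<gamma> \<omega>) + Z \<omega> \<bullet> M (Suc t) \<omega> - k \<omega>) \<omega>"
      using y'_eq by (intro Q.real_cond_exp_cong)
        (auto simp: equiv_prob_measurable[OF Q] equiv_prob_AE[OF Q])
    moreover have "AE \<omega> in Q. real_cond_exp Q (F t) (\<lambda>\<omega>. (y \<omega> - \<gamma> \<omega>) + Z \<omega> \<bullet> M (Suc t) \<omega> - k \<omega>) \<omega>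
        = real_cond_exp Q (F t) (\<lambda>\<omega>. (y \<omega> - \<gamma> \<omega>) + Z \<omega> \<bullet> M (Suc t) \<omega>) \<omega> - real_cond_exp Q (F t) k \<omega>"
      by (intro Q.real_cond_exp_diff int) measurable
    moreover have "AE \<omega> in Q. real_cond_exp Q (F t) (\<lambda>\<omega>. (y \<omega> - \<gamma> \<omega>) + Z \<omega> \<bullet> M (Suc t) \<omega>) \<omega>
        = real_cond_exp Q (F t) (\<lambda>\<omega>. y \<omega> - \<gamma> \<omega>) \<omega> + real_cond_exp Q (F t) (\<lambda>\<omega>. Z \<omega> \<bullet> M (Suc t) \<omega>) \<omega>"
      by (intro Q.real_cond_exp_add int) measurable
    moreover have "AE \<omega> in Q. real_cond_exp Q (F t) (\<lambda>\<omega>. y \<omega> - \<gamma> \<omega>) \<omega> = y \<omega> - \<gamma> \<omega>"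
      by (intro Q.real_cond_exp_F_meas int yg) measurable
    ultimately have "AE \<omega> in Q. real_cond_exp Q (F t) y' \<omega>
      = y \<omega> - \<gamma> \<omega> + real_cond_exp Q (F t) (\<lambda>\<omega>. Z \<omega> \<bullet> M (Suc t) \<omega>) \<omega> - real_cond_exp Q (F t) k \<omega>"
      by eventually_elim auto
    then show "AE \<omega> in Pr. real_cond_exp Q (F t) y' \<omega>
      = y \<omega> - \<gamma> \<omega> + real_cond_exp Q (F t) (\<lambda>\<omega>. Z \<omega> \<bullet> M (Suc t) \<omega>) \<omega> - real_cond_exp Q (F t) k \<omega>"
      unfolding equiv_prob_AE[OF Q] .
    have "AE \<omega> in Q. 0 \<le> real_cond_exp Q (F t) k \<omega>"
      using k k_nonneg by (intro Q.real_cond_exp_pos) (auto simp: equiv_prob_measurable[OF Q] equiv_prob_AE[OF Q])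
    then show "AE \<omega> in Pr. 0 \<le> real_cond_exp Q (F t) k \<omega>"
      unfolding equiv_prob_AE[OF Q] .
    \<comment> \<open>Since \<open>y - u\<close> is known at time \<open>t\<close>, the
      complementarity condition passes from \<open>k\<close> to its conditional expectation under
      each prior.\<close>
    have "AE \<omega> in Q. real_cond_exp Q (F t) (\<lambda>\<omega>. (y \<omega> - u \<omega>) * k \<omega>) \<omega> = (y \<omega> - u \<omega>) * real_cond_exp Q (F t) k \<omega>"
      using y u k by (intro Q.real_cond_exp_mult int) (auto simp: equiv_prob_measurable[OF Q])
    moreover have "AE \<omega> in Q. real_cond_exp Q (F t) (\<lambda>\<omega>. (y \<omega> - u \<omega>) * k \<omega>) \<omega> = real_cond_exp Q (F t) (\<lambda>\<omega>. 0) \<omega>"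
      using sk by (intro Q.real_cond_exp_cong) (auto simp: equiv_prob_measurable[OF Q] equiv_prob_AE[OF Q])
    moreover have "AE \<omega> in Q. real_cond_exp Q (F t) (\<lambda>\<omega>. 0) \<omega> = 0"
      by (rule Q.real_cond_exp_F_meas) auto
    ultimately have "AE \<omega> in Q. (y \<omega> - u \<omega>) * real_cond_exp Q (F t) k \<omega> = 0"
      by eventually_elim auto
    then show "AE \<omega> in Pr. (y \<omega> - u \<omega>) * real_cond_exp Q (F t) k \<omega> = 0"
      unfolding equiv_prob_AE[OF Q] .
  qed
  have e_le_c: "\<And>Q. Q \<in> \<Lambda> \<Longrightarrow> AE \<omega> in Pr. e \<omega> \<le> ereal (real_cond_exp Q (F t) y' \<omega>)"
    and e_greatest: "\<And>h. h \<in> borel_measurable Pr \<Longrightarrow>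
      (\<And>Q. Q \<in> \<Lambda> \<Longrightarrow> AE \<omega> in Pr. h \<omega> \<le> ereal (real_cond_exp Q (F t) y' \<omega>)) \<Longrightarrow> AE \<omega> in Pr. h \<omega> \<le> e \<omega>"
    and g_le: "\<And>\<theta>. \<theta> \<in> ?\<Theta> \<Longrightarrow> AE \<omega> in Pr. g \<omega> \<le> ereal (Z \<omega> \<bullet> \<theta> t \<omega>)"
    and g_greatest: "\<And>h. h \<in> borel_measurable Pr \<Longrightarrow>
      (\<And>\<theta>. \<theta> \<in> ?\<Theta> \<Longrightarrow> AE \<omega> in Pr. h \<omega> \<le> ereal (Z \<omega> \<bullet> \<theta> t \<omega>)) \<Longrightarrow> AE \<omega> in Pr. h \<omega> \<le> g \<omega>"
    using e(2) g unfolding is_ess_inf_def by auto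
  \<comment> \<open>For the prior belonging to \<theta>, \<open>decomp\<close> and the
    non-negativity of the conditional expectation of \<open>k\<close> bound this by
    \<open>Z \<bullet> \<theta> t\<close>. So it lies below the infimum \<open>g\<close>, which
    equals \<gamma>, and cancelling \<gamma> leaves \<open>e \<le> y\<close>.\<close>
  have "AE \<omega> in Pr. e \<omega> + ereal (\<gamma> \<omega> - y \<omega>) \<le> g \<omega>"
  proof (rule g_greatest)
    show "(\<lambda>\<omega>. e \<omega> + ereal (\<gamma> \<omega> - y \<omega>)) \<in> borel_measurable Pr"
      using Pr[OF e(1)] Pr[OF y] Pr[OF \<gamma>] by measurable
    fix \<theta> assume "\<theta> \<in> ?\<Theta>"
    then obtain Q where Q: "Q \<in> \<Lambda>"
      "AE \<omega> in Pr. real_cond_exp Q (F t) (\<lambda>\<omega>. Z \<omega> \<bullet> M (Suc t) \<omega>) \<omega> = Z \<omega> \<bullet> \<theta> t \<omega>"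
      using Theta_set_cond_exp(1)[OF \<Lambda>(2) t Z] by blast
    show "AE \<omega> in Pr. e \<omega> + ereal (\<gamma> \<omega> - y \<omega>) \<le> ereal (Z \<omega> \<bullet> \<theta> t \<omega>)"
      using Q(2) e_le_c[OF Q(1)] decomp[OF Q(1)] k_pos[OF Q(1)]
    proof eventually_elim
      case (elim \<omega>)
      then show ?case by (cases "e \<omega>") auto
    qed
  qed
  then have e_le: "AE \<omega> in Pr. e \<omega> \<le> ereal (y \<omega>)"
    using y'_eq
  proof eventually_elim
    case (elim \<omega>)
    then show ?case by (cases "e \<omega>") auto
  qed
  txt \<open>\<open>h\<close> is again a lower bound: on \<open>{u < y}\<close> the conditional expectation of \<open>k\<close> vanishes.\<close>
  define h where "h \<omega> = (if u \<omega> < y \<omega> then ereal (y \<omega>) else e \<omega>)" for \<omega>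
  have "AE \<omega> in Pr. h \<omega> \<le> e \<omega>"
  proof (rule e_greatest)
    show "h \<in> borel_measurable Pr"
      unfolding h_def using Pr[OF e(1)] Pr[OF y] Pr[OF u] by measurable
    fix Q assume Q: "Q \<in> \<Lambda>"
    then obtain \<theta> where \<theta>: "\<theta> \<in> ?\<Theta>"
      "AE \<omega> in Pr. real_cond_exp Q (F t) (\<lambda>\<omega>. Z \<omega> \<bullet> M (Suc t) \<omega>) \<omega> = Z \<omega> \<bullet> \<theta> t \<omega>"
      using Theta_set_cond_exp(2)[OF \<Lambda>(2) t Z] by blast
    show "AE \<omega> in Pr. h \<omega> \<le> ereal (real_cond_exp Q (F t) y' \<omega>)"
      using \<theta>(2) g_le[OF \<theta>(1)] y'_eq decomp[OF Q] k_zero[OF Q] e_le_c[OF Q]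
      by eventually_elim (auto simp: h_def)
  qed
  \<comment> \<open>Where \<open>u < y\<close>, both bounds give \<open>e = y\<close>. Elsewhere
    \<open>u = y\<close>, and \<open>e \<le> y\<close> makes the maximum equal to
    \<open>u\<close>.\<close>
  with e_le y_ge show ?thesis
    by eventually_elim (auto simp: h_def max_def split: if_splits intro: antisym)
qed

end

text \<open>The recursion fixes the envelope only up to null sets. Equality with it is therefore
  expressed as \<open>Y\<close> satisfying the recursion together with indistinguishability of
  \<open>Y\<close> from every process that does.\<close>

theorem theorem3p13:
  fixes Pr :: "'a measure"
    and X :: "nat \<Rightarrow> 'a \<Rightarrow> real ^ 'm"
    and T :: nat
    and \<Lambda> :: "'a measure set"
    and U Y K :: "nat \<Rightarrow> 'a \<Rightarrow> real"
    and Z :: "nat \<Rightarrow> 'a \<Rightarrow> real ^ 'm"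
  assumes "T > 0"
    and "prob_space Pr"
    and "\<And>t. t \<le> T \<Longrightarrow> X t \<in> borel_measurable Pr"
    and "\<And>t \<omega>. t \<le> T \<Longrightarrow> \<omega> \<in> space Pr \<Longrightarrow> X t \<omega> \<in> range (\<lambda>i. axis i 1)"
    and "sets Pr = sets (filt Pr X T)"
    and "\<And>A. A \<in> sets (filt Pr X 0) \<Longrightarrow> measure Pr A = 0 \<or> measure Pr A = 1"
    and "\<Lambda> \<noteq> {}"
    and "\<And>Q. Q \<in> \<Lambda> \<Longrightarrow> prob_space Q \<and> sets Q = sets Pr \<and>
           absolutely_continuous Pr Q \<and> absolutely_continuous Q Pr"
    and "time_consistent Pr X T \<Lambda>"
    and "\<And>t. t \<le> T \<Longrightarrow> U t \<in> borel_measurable (filt Pr X t)"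
    and "integrable Pr (U T)"
    and "reflected_bsde_solution Pr X T \<Lambda> U Y Z K"
  shows "multiple_prior_snell_envelope Pr X T \<Lambda> U Y \<and>
         (\<forall>V. multiple_prior_snell_envelope Pr X T \<Lambda> U V \<longrightarrow>
            (AE \<omega> in Pr. \<forall>t\<le>T. Y t \<omega> = V t \<omega>))"
proof -
  interpret path_model Pr X T
    using assms(2-6) by (simp add: path_model_def path_model_axioms_def)
  have \<Lambda>: "equiv_prob Q" if "Q \<in> \<Lambda>" for Q
    using assms(8)[OF that] by (simp add: equiv_prob_def)
  note sol = assms(12)[unfolded reflected_bsde_solution_def]
  have Ym: "Y t \<in> borel_measurable (F t)" if "t \<le> T" for t
    using sol that by blast
  have Y: "multiple_prior_snell_envelope Pr X T \<Lambda> U Y"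
    unfolding multiple_prior_snell_envelope_def
  proof (intro conjI allI impI)
    fix t assume t: "t < T"
    then have T: "t \<le> T" "Suc t \<le> T" by auto
    obtain e where e: "e \<in> borel_measurable (F t)"
      "is_ess_inf Pr \<Lambda> (\<lambda>Q. real_cond_exp Q (F t) (Y (Suc t))) e"
      using ess_inf_cond_exp_exists[OF assms(7) T(1)] .
    obtain g where g: "is_ess_inf Pr (Theta_set Pr X T \<Lambda>) (\<lambda>\<theta> \<omega>. Z t \<omega> \<bullet> \<theta> t \<omega>) g"
      "AE \<omega> in Pr. ereal (Y t \<omega>) = ereal (Y (Suc t) \<omega>) + g \<omega> - ereal (Z t \<omega> \<bullet> M (Suc t) \<omega>)
        + ereal (K (Suc t) \<omega> - K t \<omega>)"
      using sol t by blast
    have "integrable Pr (K t)" "integrable Pr (K (Suc t))"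
      using sol T by blast+
    then have "(\<lambda>\<omega>. K (Suc t) \<omega> - K t \<omega>) \<in> borel_measurable Pr"
      by (intro borel_measurable_diff borel_measurable_integrable)
    moreover have "AE \<omega> in Pr. K t \<omega> \<le> K (Suc t) \<omega>" using sol t by blast
    then have "AE \<omega> in Pr. 0 \<le> K (Suc t) \<omega> - K t \<omega>" by eventually_elim auto
    ultimately have "AE \<omega> in Pr. ereal (Y t \<omega>) = max (ereal (U t \<omega>)) (e \<omega>)"
      using sol t T
      by (intro reflected_step[OF assms(7) \<Lambda> t Ym[OF T(1)] assms(10)[OF T(1)] _
            measurable_F_Pr[OF T(2) Ym[OF T(2)]] _ _ g _ _ e]) auto
    with e(2) show "\<exists>g. is_ess_inf Pr \<Lambda> (\<lambda>Q. real_cond_exp Q (F t) (Y (Suc t))) g \<and>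
        (AE \<omega> in Pr. ereal (Y t \<omega>) = max (ereal (U t \<omega>)) (g \<omega>))" by blast
  qed (use sol in blast)+
  moreover have "AE \<omega> in Pr. \<forall>t\<le>T. Y t \<omega> = V t \<omega>"
    if "multiple_prior_snell_envelope Pr X T \<Lambda> U V" for V
  proof -
    note V = that[unfolded multiple_prior_snell_envelope_def]
    note Y = Y[unfolded multiple_prior_snell_envelope_def]
    \<comment> \<open>Backward induction: if the next values agree almost surely, so do their
      conditional expectations under every prior, by equivalence to \<open>Pr\<close>, and hence the
      essential infima.\<close>
    have "AE \<omega> in Pr. Y t \<omega> = V t \<omega>" if "t \<le> T" for t
      using that
    proof (induction t rule: inc_induct)
      case base
      have "AE \<omega> in Pr. Y T \<omega> = U T \<omega>" "AE \<omega> in Pr. V T \<omega> = U T \<omega>" using Y V by auto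
      then show ?case by eventually_elim simp
    next
      case (step t)
      then have T: "t \<le> T" "Suc t \<le> T" by auto
      obtain g where g: "is_ess_inf Pr \<Lambda> (\<lambda>Q. real_cond_exp Q (F t) (Y (Suc t))) g"
        "AE \<omega> in Pr. ereal (Y t \<omega>) = max (ereal (U t \<omega>)) (g \<omega>)"
        using Y step(2) by blast
      obtain g' where g': "is_ess_inf Pr \<Lambda> (\<lambda>Q. real_cond_exp Q (F t) (V (Suc t))) g'"
        "AE \<omega> in Pr. ereal (V t \<omega>) = max (ereal (U t \<omega>)) (g' \<omega>)"
        using V step(2) by blast
      have cong: "AE \<omega> in Pr. real_cond_exp Q (F t) (Y (Suc t)) \<omega> = real_cond_exp Q (F t) (V (Suc t)) \<omega>"
        if "Q \<in> \<Lambda>" for Q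
      proof -
        note Q = \<Lambda>[OF that]
        interpret Q: finite_measure_subalgebra Q "F t" by (rule equiv_prob_subalgebra[OF Q T(1)])
        have "Y (Suc t) \<in> borel_measurable Pr" "V (Suc t) \<in> borel_measurable Pr"
          using V Y T by (auto intro: measurable_F_Pr[OF T(2)])
        then have "AE \<omega> in Q. real_cond_exp Q (F t) (Y (Suc t)) \<omega> = real_cond_exp Q (F t) (V (Suc t)) \<omega>"
          using step.IH by (intro Q.real_cond_exp_cong) (auto simp: equiv_prob_measurable[OF Q] equiv_prob_AE[OF Q])
        then show ?thesis unfolding equiv_prob_AE[OF Q] .
      qed
      have "AE \<omega> in Pr. g \<omega> = g' \<omega>"
        by (rule is_ess_inf_AE_unique[OF g(1) g'(1)]) (use cong in blast)+
      with g(2) g'(2) show ?case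
        by eventually_elim (metis ereal.inject)
    qed
    \<comment> \<open>Finitely many times leave one common null set, so equality at each time
      becomes indistinguishability.\<close>
    then have "AE \<omega> in Pr. \<forall>t\<in>{..T}. Y t \<omega> = V t \<omega>"
      by (intro AE_finite_allI) auto
    then show ?thesis by eventually_elim auto
  qed
  ultimately show ?thesis by blast
qed

end
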